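(* Let $p\ge 3$ be a prime number and let $\vec G=(V,\vec E)$ be a directed graph whose underlying undirected graph is $(6p-8)(p-1)$-edge-connected. For each arc $\vec e\in\vec E$, let $L(\vec e)$ be a set of two distinct elements of $\mathbb{Z}_p$. Then for every $\mathbb{Z}_p$-boundary $\beta$, $\vec G$ has a $\mathbb{Z}_p$-flow $f$ with boundary $\beta$ such that $f(\vec e)\in L(\vec e)$ for every $\vec e\in\vec E$.
   Context: Graphs are finite and may have multiple edges but no loops. A $\mathbb{Z}_p$-boundary is a map $\beta:V\to\mathbb{Z}_p$ with $\sum_{v\in V}\beta(v)\equiv 0\pmod p$. For $v\in V$, $\delta^+_{\vec G}(v)$ (resp. $\delta^-_{\vec G}(v)$) is the set of arcs leaving (resp. entering) $v$. A $\mathbb{Z}_p$-flow with boundary $\beta$ in $\vec G$ is a map $f:\vec E\to\mathbb{Z}_p$ such that $\partial f(v):=\sum_{\vec e\in\delta^+_{\vec G}(v)}f(\vec e)-\sum_{\vec e\in\delta^-_{\vec G}(v)}f(\vec e)\equiv\beta(v)\pmod p$ for every $v\in V$. *)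

theory Defs
  imports Main "HOL-Computational_Algebra.Primes" "Graph_Theory.Digraph"
begin

definition cut_arcs :: "('a,'b) pre_digraph \<Rightarrow> 'a set \<Rightarrow> 'b set" where
  "cut_arcs G X = {e \<in> arcs G. (tail G e \<in> X) \<noteq> (head G e \<in> X)}"

definition edge_connected :: "nat \<Rightarrow> ('a,'b) pre_digraph \<Rightarrow> bool" where
  "edge_connected k G \<longleftrightarrow>
     (\<forall>X. X \<subseteq> verts G \<and> X \<noteq> {} \<and> X \<noteq> verts G \<longrightarrow> k \<le> card (cut_arcs G X))"

text \<open>Z_p is represented by the integers {0..<p}; equalities in Z_p are congruences mod p.\<close>
definition is_Zp_boundary :: "int \<Rightarrow> ('a,'b) pre_digraph \<Rightarrow> ('a \<Rightarrow> int) \<Rightarrow> bool" where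
  "is_Zp_boundary p G \<beta> \<longleftrightarrow>
     (\<forall>v \<in> verts G. \<beta> v \<in> {0..<p}) \<and> (\<Sum>v \<in> verts G. \<beta> v) mod p = 0"

definition is_Zp_flow :: "int \<Rightarrow> ('a,'b) pre_digraph \<Rightarrow> ('a \<Rightarrow> int) \<Rightarrow> ('b \<Rightarrow> int) \<Rightarrow> bool" where
  "is_Zp_flow p G \<beta> f \<longleftrightarrow>
     (\<forall>e \<in> arcs G. f e \<in> {0..<p}) \<and>
     (\<forall>v \<in> verts G. ((\<Sum>e \<in> out_arcs G v. f e) - (\<Sum>e \<in> in_arcs G v. f e)) mod p = \<beta> v mod p)"

end

theory Submission
  imports Defs
begin

text \<open>
Replacing each list \<open>{a, b}\<close> by \<open>m \<plusminus> h\<close> with \<open>m = (a + b) / 2\<close> and \<open>h = (b - a) / 2\<close>, a flow becomes a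
choice of signs \<open>s\<close> such that \<open>s h\<close> has a prescribed boundary. Colour the arcs by \<open>\<plusminus>h\<close>. Some of the
\<open>(p - 1) / 2\<close> colours has so many arcs that it contains a \<open>(5 p - 4)\<close>-edge-connected subgraph
spanned by at least two vertices. Contract that subgraph, solve the smaller problem by induction, and
then choose the signs inside the subgraph anew: there all \<open>h\<close> agree up to sign, so what is needed is
an orientation of a highly edge-connected multigraph with prescribed net outdegrees modulo \<open>p\<close>.

Such orientations come from an induction in the spirit of Lovasz, Thomassen, Wu and Zhang. Fix a root
\<open>z\<close> whose edges are already oriented and require \<open>d(A) \<ge> 4 k - 4 + |\<tau>(A)|\<close> for all non-empty
vertex sets \<open>A\<close> whose complement contains \<open>z\<close> and another vertex, where \<open>\<tau>(A)\<close> is the demand of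
\<open>A\<close> modulo \<open>2 k\<close> and \<open>|\<tau>(A)|\<close> its distance to \<open>0\<close>. If equality holds for some \<open>A\<close> with at least two
vertices, contract \<open>A\<close> and afterwards its complement. A vertex of demand \<open>0\<close> can be split off
completely. Otherwise edges are oriented and deleted until all demands have the same sign; then the
bounds on the in- and outdegree of the root leave room for shifting the whole demand of one vertex
to the root, and that vertex is split off.
\<close>

section \<open>Distance to the multiples of an even modulus\<close>

text \<open>The modulus is \<open>2 * k\<close> because the parity of a net outdegree is forced by
  the degree: for odd \<open>k\<close>, a residue modulo \<open>k\<close> and that parity combine
  into one residue modulo \<open>2 * k\<close>.\<close>

definition mod_norm :: "int \<Rightarrow> int \<Rightarrow> int" where
  "mod_norm k z = min (z mod (2 * k)) (2 * k - z mod (2 * k))"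

text \<open>With \<open>mod_norm_attained\<close> this characterises \<open>mod_norm k z\<close> as
  the minimum of the distances from \<open>z\<close> to the multiples of \<open>2 * k\<close>;
  symmetry, the triangle inequality and parity are derived from that.\<close>

lemma mod_norm_le:
  assumes "k > 0" shows "mod_norm k z \<le> \<bar>z - 2 * k * j\<bar>"
proof -
  define r q where "r = z mod (2 * k)" and "q = z div (2 * k)"
  have z: "z = 2 * k * q + r" by (simp add: r_def q_def)
  have r: "0 \<le> r" "r < 2 * k" using assms by (simp_all add: r_def)
  have e: "z - 2 * k * j = 2 * k * (q - j) + r" using z by (simp add: algebra_simps)
  consider "q - j = 0" | "q - j \<ge> 1" | "q - j \<le> -1" by linarith
  then show ?thesis
  proof cases
    case 1 then show ?thesis using e r by (simp add: mod_norm_def r_def)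
  next
    case 2
    then have "2 * k * (q - j) \<ge> 2 * k * 1" using assms by (intro mult_left_mono) auto
    moreover have "mod_norm k z \<le> r" by (simp add: mod_norm_def r_def)
    ultimately show ?thesis using e r by linarith
  next
    case 3
    then have "2 * k * (q - j) \<le> 2 * k * (-1)" using assms by (intro mult_left_mono) auto
    then show ?thesis using e r by (simp add: mod_norm_def flip: r_def)
  qed
qed

lemma mod_norm_attained: "\<exists>j. mod_norm k z = \<bar>z - 2 * k * j\<bar>" if "k > 0"
proof -
  define r q where "r = z mod (2 * k)" and "q = z div (2 * k)"
  have z: "z = 2 * k * q + r" by (simp add: r_def q_def)
  have r: "0 \<le> r" "r < 2 * k" using that by (simp_all add: r_def)
  show ?thesis
  proof (cases "r \<le> 2 * k - r")
    case True
    then have "mod_norm k z = \<bar>z - 2 * k * q\<bar>" using z r by (simp add: mod_norm_def flip: r_def)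
    then show ?thesis by blast
  next
    case False
    then have "mod_norm k z = 2 * k - r" by (simp add: mod_norm_def flip: r_def)
    moreover have "z - 2 * k * (q + 1) = r - 2 * k" using z by (simp add: algebra_simps)
    ultimately have "mod_norm k z = \<bar>z - 2 * k * (q + 1)\<bar>" using r by linarith
    then show ?thesis by blast
  qed
qed

lemma mod_norm_bounds: assumes "k > 0" shows "0 \<le> mod_norm k z" "mod_norm k z \<le> k"
  using pos_mod_bound[of "2*k" z] pos_mod_sign[of "2*k" z] assms by (auto simp: mod_norm_def min_def simp del: pos_mod_bound pos_mod_sign)

lemma mod_norm_cong: "2 * k dvd x - y \<Longrightarrow> mod_norm k x = mod_norm k y"
  by (simp only: mod_norm_def flip: mod_eq_dvd_iff)

lemma mod_norm_uminus: assumes "k > 0" shows "mod_norm k (- z) = mod_norm k z"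
proof -
  have "mod_norm k (- y) \<le> mod_norm k y" for y
  proof -
    obtain j where "mod_norm k y = \<bar>y - 2 * k * j\<bar>" using mod_norm_attained[OF assms] by blast
    then show ?thesis using mod_norm_le[OF assms, of "- y" "- j"] by simp
  qed
  from this[of z] this[of "- z"] show ?thesis by simp
qed

lemma mod_norm_triangle: assumes "k > 0" shows "mod_norm k (x + y) \<le> mod_norm k x + mod_norm k y"
proof -
  obtain i where i: "mod_norm k x = \<bar>x - 2 * k * i\<bar>" using mod_norm_attained[OF assms] by blast
  obtain j where j: "mod_norm k y = \<bar>y - 2 * k * j\<bar>" using mod_norm_attained[OF assms] by blast
  have "mod_norm k (x + y) \<le> \<bar>(x - 2 * k * i) + (y - 2 * k * j)\<bar>"
    using mod_norm_le[OF assms, of "x + y" "i + j"] by (simp add: algebra_simps)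
  then show ?thesis using i j by linarith
qed

lemma mod_norm_le_abs: "k > 0 \<Longrightarrow> mod_norm k z \<le> \<bar>z\<bar>"
  using mod_norm_le[of k z 0] by simp

lemma mod_norm_lipschitz: "k > 0 \<Longrightarrow> mod_norm k (x + y) \<le> mod_norm k x + \<bar>y\<bar>"
  using mod_norm_triangle[of k x y] mod_norm_le_abs[of k y] by linarith

text \<open>A shift by a multiple of \<open>2 * k\<close> and an absolute value both preserve
  parity.\<close>

lemma mod_norm_parity: assumes "k > 0" shows "even (mod_norm k z - z)"
proof -
  obtain j where "mod_norm k z = \<bar>z - 2 * k * j\<bar>" using mod_norm_attained[OF assms] by blast
  then show ?thesis by (simp add: abs_if)
qed

lemma mod_norm_0: "k > 0 \<Longrightarrow> 2 * k dvd z \<Longrightarrow> mod_norm k z = 0"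
  by (simp add: mod_norm_def)

lemma mod_norm_self: assumes "0 \<le> t" "t \<le> k" shows "mod_norm k t = t"
  using assms by (cases "k = 0") (auto simp: mod_norm_def)

text \<open>One of two ways of bringing a residue one step closer to \<open>0\<close>, the other
  being \<open>mod_norm_succ\<close>. A nonzero residue admits at least one of them, the residue
  \<open>k\<close> both; this later decides in which direction an edge at a vertex may be oriented
  and deleted.\<close>

lemma mod_norm_pred: assumes "k > 0" "0 < z mod (2 * k)" "z mod (2 * k) \<le> k"
  shows "mod_norm k (z - 1) = mod_norm k z - 1"
proof -
  have "mod_norm k z = z mod (2 * k)" using assms by (simp add: mod_norm_def)
  moreover have "mod_norm k (z - 1) = mod_norm k (z mod (2 * k) - 1)"
    by (rule mod_norm_cong) (simp add: minus_mod_eq_mult_div)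
  ultimately show ?thesis using mod_norm_self[of "z mod (2 * k) - 1" k] assms by simp
qed

lemma mod_norm_succ: assumes "k > 0" "k \<le> z mod (2 * k)"
  shows "mod_norm k (z + 1) = mod_norm k z - 1"
proof -
  let ?r = "z mod (2 * k)"
  have r: "?r < 2 * k" using assms by simp
  have "mod_norm k z = 2 * k - ?r" using assms r by (simp add: mod_norm_def)
  moreover have "mod_norm k (z + 1) = mod_norm k (- (2 * k - ?r - 1))"
  proof (rule mod_norm_cong)
    have "z + 1 - - (2 * k - ?r - 1) = 2 * k * (z div (2 * k) + 1)"
      using mult_div_mod_eq[of "2 * k" z] by (simp add: algebra_simps)
    then show "2 * k dvd z + 1 - - (2 * k - ?r - 1)" by (simp only: dvd_triv_left)
  qed
  moreover have "mod_norm k (- (2 * k - ?r - 1)) = 2 * k - ?r - 1"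
    using mod_norm_self[of "2 * k - ?r - 1" k] assms r by (subst mod_norm_uminus) auto
  ultimately show ?thesis by linarith
qed

section \<open>Rooted instances: cuts, demands and the reversal of all arcs\<close>

definition flux :: "'v \<times> 'v \<Rightarrow> 'v set \<Rightarrow> int" where
  "flux d A = of_bool (fst d \<in> A) - of_bool (snd d \<in> A)"

lemma sum_flux: "finite A \<Longrightarrow> (\<Sum>v\<in>A. flux d {v}) = flux d A"
  by (simp add: flux_def sum_subtractf)

lemma abs_flux: "\<bar>flux d A\<bar> = of_bool ((fst d \<in> A) \<noteq> (snd d \<in> A))"
  by (simp add: flux_def)

text \<open>The root is not a vertex: \<open>P v\<close> counts the edges oriented from the root to \<open>v\<close>, and \<open>Q v\<close> those
  oriented from \<open>v\<close> to the root. The net outdegree \<open>c v\<close> asked of \<open>v\<close> refers to the edges in \<open>E\<close> only, so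
  \<open>P\<close> and \<open>Q\<close> merely decompose \<open>c\<close> and do not occur in \<open>orientable\<close> below.\<close>
definition rcut :: "'e set \<Rightarrow> ('e \<Rightarrow> 'v \<times> 'v) \<Rightarrow> ('v \<Rightarrow> int) \<Rightarrow> ('v \<Rightarrow> int) \<Rightarrow> 'v set \<Rightarrow> int" where
  "rcut E g P Q A = (\<Sum>e\<in>E. \<bar>flux (g e) A\<bar>) + (\<Sum>v\<in>A. P v + Q v)"

text \<open>The net outdegree asked of \<open>A\<close> when root edges are counted as well: arcs
  from the root to \<open>v\<close> lower it, arcs from \<open>v\<close> to the root raise
  it.\<close>

definition demand :: "('v \<Rightarrow> int) \<Rightarrow> ('v \<Rightarrow> int) \<Rightarrow> ('v \<Rightarrow> int) \<Rightarrow> 'v set \<Rightarrow> int" where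
  "demand c P Q A = (\<Sum>v\<in>A. c v - P v + Q v)"

definition orientable :: "int \<Rightarrow> 'v set \<Rightarrow> 'e set \<Rightarrow> ('e \<Rightarrow> 'v \<times> 'v) \<Rightarrow> ('v \<Rightarrow> int) \<Rightarrow> bool" where
  "orientable k W E g c \<longleftrightarrow>
     (\<exists>s. (\<forall>e\<in>E. s e = 1 \<or> s e = (-1::int)) \<and>
          (\<forall>v\<in>W. 2 * k dvd (\<Sum>e\<in>E. s e * flux (g e) {v}) - c v))"

text \<open>\<open>a\<close> and \<open>b\<close> are the outdegree and the indegree of the root. The conditions hold for the root that
  results from contracting the complement of a tight set (\<open>tight_root_bounded\<close>), and they survive both
  moving a vertex into the root (\<open>zero_step\<close>) and shifting a demand to it (\<open>positive_step\<close>).\<close>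
definition root_bounded :: "int \<Rightarrow> int \<Rightarrow> int \<Rightarrow> bool" where
  "root_bounded k a b \<longleftrightarrow> a \<le> 4 * k - 2 \<and> b \<le> 4 * k - 2 \<and>
     (min a b \<le> 2 * k - 2 \<or> max a b \<le> 3 * k - 1) \<and> a + b \<le> 6 * k - 6 + mod_norm k (a - b)"

text \<open>The divisibility of \<open>sum c W\<close> and the parity condition are necessary for
  any orientation: net outdegrees add up to 0, and each has the parity of the degree.\<close>

definition rooted :: "int \<Rightarrow> 'v set \<Rightarrow> 'e set \<Rightarrow> ('e \<Rightarrow> 'v \<times> 'v) \<Rightarrow> ('v \<Rightarrow> int) \<Rightarrow> ('v \<Rightarrow> int) \<Rightarrow> ('v \<Rightarrow> int) \<Rightarrow> bool" where
  "rooted k W E g c P Q \<longleftrightarrow> finite W \<and> finite E \<and> (\<forall>e\<in>E. fst (g e) \<in> W \<and> snd (g e) \<in> W) \<and>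
     (\<forall>v\<in>W. 0 \<le> P v \<and> 0 \<le> Q v) \<and> 2 * k dvd sum c W \<and>
     (\<forall>v\<in>W. even (c v - (\<Sum>e\<in>E. flux (g e) {v}))) \<and> root_bounded k (sum P W) (sum Q W)"

text \<open>The sets in \<open>X\<close> are exempt: while a vertex \<open>x\<close> is being split off, nothing is required of \<open>{x}\<close> and of
  its complement.\<close>
definition cut_condition :: "int \<Rightarrow> 'v set \<Rightarrow> 'e set \<Rightarrow> ('e \<Rightarrow> 'v \<times> 'v) \<Rightarrow> ('v \<Rightarrow> int) \<Rightarrow> ('v \<Rightarrow> int) \<Rightarrow> ('v \<Rightarrow> int) \<Rightarrow> 'v set set \<Rightarrow> bool" where
  "cut_condition k W E g c P Q X \<longleftrightarrow>
     (\<forall>A. A \<subseteq> W \<longrightarrow> A \<noteq> {} \<longrightarrow> A \<noteq> W \<longrightarrow> A \<notin> X \<longrightarrow> 4 * k - 4 + mod_norm k (demand c P Q A) \<le> rcut E g P Q A)"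

lemma cut_conditionD: "cut_condition k W E g c P Q X \<Longrightarrow> A \<subseteq> W \<Longrightarrow> A \<noteq> {} \<Longrightarrow> A \<noteq> W \<Longrightarrow> A \<notin> X \<Longrightarrow>
   4 * k - 4 + mod_norm k (demand c P Q A) \<le> rcut E g P Q A"
  by (simp add: cut_condition_def)

lemma demand_sum: "demand c P Q A = sum c A - sum P A + sum Q A"
  by (simp add: demand_def sum.distrib sum_subtractf)

lemma demand_uminus: "demand (\<lambda>v. - c v) Q P A = - demand c P Q A"
  by (simp add: demand_sum sum_negf)

lemma rcut_swap: "rcut E g Q P A = rcut E g P Q A"
  by (simp add: rcut_def add.commute)

text \<open>Reversing all arcs negates \<open>c\<close> and exchanges \<open>P\<close> with
  \<open>Q\<close>. With the next two lemmas this lets every later argument treat one direction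
  only.\<close>

lemma orientable_uminus:
  assumes "orientable k W E g (\<lambda>v. - c v)" shows "orientable k W E g c"
proof -
  obtain s where s: "\<forall>e\<in>E. s e = 1 \<or> s e = (-1::int)"
    "\<forall>v\<in>W. 2 * k dvd (\<Sum>e\<in>E. s e * flux (g e) {v}) - - c v"
    using assms by (auto simp: orientable_def)
  show ?thesis unfolding orientable_def
  proof (rule exI[of _ "\<lambda>e. - s e"], intro conjI ballI)
    fix v assume "v \<in> W"
    then have "2 * k dvd - ((\<Sum>e\<in>E. s e * flux (g e) {v}) - - c v)"
      using s(2) dvd_minus_iff by blast
    then show "2 * k dvd (\<Sum>e\<in>E. - s e * flux (g e) {v}) - c v"
      by (simp add: sum_negf)
  qed (use s(1) in auto)
qed

lemma rooted_uminus:
  assumes "k > 0" "rooted k W E g c P Q" shows "rooted k W E g (\<lambda>v. - c v) Q P"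
proof -
  have "root_bounded k (sum Q W) (sum P W)"
    using assms mod_norm_uminus[OF assms(1), of "sum P W - sum Q W"]
    by (auto simp: rooted_def root_bounded_def min.commute max.commute add.commute)
  moreover have "even (- c v - (\<Sum>e\<in>E. flux (g e) {v}))" if "v \<in> W" for v
    using assms that by (auto simp: rooted_def)
  ultimately show ?thesis using assms by (auto simp: rooted_def sum_negf)
qed

lemma cut_condition_uminus:
  assumes "k > 0" "cut_condition k W E g c P Q X" shows "cut_condition k W E g (\<lambda>v. - c v) Q P X"
  using assms by (simp add: cut_condition_def demand_uminus rcut_swap mod_norm_uminus)

text \<open>Modulo 2 signs and absolute values disappear, so the cut and the demand both become the
  sum of the fluxes plus \<open>sum P A + sum Q A\<close>.\<close>

lemma rooted_parity:
  assumes k: "k > 0" and v: "rooted k W E g c P Q" and A: "A \<subseteq> W"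
  shows "even (rcut E g P Q A - mod_norm k (demand c P Q A))"
proof -
  have fA: "finite A" using v A finite_subset by (auto simp: rooted_def)
  have "even (\<Sum>v\<in>A. c v - (\<Sum>e\<in>E. flux (g e) {v}))"
    using v A by (intro dvd_sum) (auto simp: rooted_def)
  also have "(\<Sum>v\<in>A. c v - (\<Sum>e\<in>E. flux (g e) {v})) = sum c A - (\<Sum>e\<in>E. flux (g e) A)"
    using fA by (subst sum_subtractf, subst sum.swap) (simp add: sum_flux)
  finally have 1: "even (sum c A - (\<Sum>e\<in>E. flux (g e) A))" .
  have "even (\<Sum>e\<in>E. \<bar>flux (g e) A\<bar> - flux (g e) A)"
    by (intro dvd_sum) (auto simp: flux_def)
  then have 2: "even ((\<Sum>e\<in>E. \<bar>flux (g e) A\<bar>) - (\<Sum>e\<in>E. flux (g e) A))"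
    by (simp add: sum_subtractf)
  have "even (mod_norm k (demand c P Q A) - demand c P Q A)" using mod_norm_parity[OF k] .
  with 1 2 have "even ((\<Sum>e\<in>E. \<bar>flux (g e) A\<bar>) + (sum P A + sum Q A) - mod_norm k (demand c P Q A))"
    unfolding demand_sum by (simp, presburger)
  then show ?thesis by (simp add: rcut_def sum.distrib)
qed

text \<open>By parity, an inequality that is not tight has slack at least 2.\<close>
lemma slack2:
  assumes "k > 0" "rooted k W E g c P Q" "cut_condition k W E g c P Q X"
    and "A \<subseteq> W" "A \<noteq> {}" "A \<noteq> W" "A \<notin> X" and "rcut E g P Q A \<noteq> 4 * k - 4 + mod_norm k (demand c P Q A)"
  shows "4 * k - 2 + mod_norm k (demand c P Q A) \<le> rcut E g P Q A"
proof -
  have "4 * k - 4 + mod_norm k (demand c P Q A) < rcut E g P Q A" using cut_conditionD[OF assms(3-7)] assms(8) by linarith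
  moreover have "even (rcut E g P Q A - mod_norm k (demand c P Q A))" using rooted_parity assms by blast
  ultimately show ?thesis by presburger
qed

section \<open>Restriction and contraction\<close>

text \<open>Let \<open>n\<close> be the norm of \<open>a - b\<close>, so that \<open>a - b\<close>
  is \<open>2 * k * j\<close> plus or minus \<open>n\<close>. Solving for \<open>a\<close> and
  \<open>b\<close> gives \<open>2 * k - 2 + k * j\<close> and \<open>2 * k - 2 - k * j\<close>, with
  \<open>n\<close> added to one of them. As both are nonnegative and \<open>n \<le> k\<close>, only
  \<open>j\<close> from -2 to 2 remain, and each of these satisfies the bounds.\<close>

lemma tight_root_bounded:
  fixes k a b :: int
  assumes k: "k \<ge> 3" and ab: "a \<ge> 0" "b \<ge> 0" and s: "a + b = 4 * k - 4 + mod_norm k (a - b)"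
  shows "root_bounded k a b"
proof -
  have n: "0 \<le> mod_norm k (a - b)" "mod_norm k (a - b) \<le> k" using mod_norm_bounds k by auto
  obtain j where j: "mod_norm k (a - b) = \<bar>a - b - 2 * k * j\<bar>" using mod_norm_attained[of k "a - b"] k by auto
  \<comment> \<open>The product \<open>k * j\<close> gets a name so that the case analysis is
    linear.\<close>
  define y where "y = k * j"
  have j': "mod_norm k (a - b) = \<bar>a - b - 2 * y\<bar>" using j by (simp add: y_def mult.assoc)
  have up: "y \<ge> 3 * k" if "j \<ge> 3"
    using mult_left_mono[of 3 j k] that k by (simp add: y_def mult.commute)
  have dn: "y \<le> - 3 * k" if "j \<le> -3"
    using mult_left_mono[of j "-3" k] that k by (simp add: y_def mult.commute)
  consider "j \<ge> 3" | "j = 2" | "j = 1" | "j = 0" | "j = -1" | "j = -2" | "j \<le> -3" by linarith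
  then have "y \<in> {2 * k, k, 0, - k, - 2 * k} \<or> y \<ge> 3 * k \<or> y \<le> - 3 * k"
    by cases (use up dn in \<open>auto simp: y_def\<close>)
  then have "a \<le> 4 * k - 2" "b \<le> 4 * k - 2" using n j' s ab k by auto
  then show ?thesis using s n k unfolding root_bounded_def by (auto simp: min_def max_def)
qed

text \<open>The arc has at most one end in \<open>A\<close>, so at most one summand is
  nonzero.\<close>

lemma flux_union_singletons:
  assumes "finite B" "B \<subseteq> A" "\<not> (fst d \<in> A \<and> snd d \<in> A)"
  shows "(\<Sum>v\<in>B. \<bar>flux d {v}\<bar>) = \<bar>flux d B\<bar>"
    and "(\<Sum>v\<in>B. max 0 (t * flux d {v})) = max 0 (t * flux d B)"
proof -
  have *: "(\<Sum>v\<in>B. h (flux d {v})) = h (flux d B)" if "h 0 = 0" for h :: "int \<Rightarrow> int"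
  proof (cases "\<exists>v\<in>B. fst d = v \<or> snd d = v")
    case True
    then obtain v where v: "v \<in> B" "fst d = v \<or> snd d = v" by blast
    have "flux d {u} = 0" if "u \<in> B - {v}" for u
      using assms v that by (auto simp: flux_def)
    then have "(\<Sum>u\<in>B. h (flux d {u})) = h (flux d {v})"
      using v(1) assms(1) \<open>h 0 = 0\<close> by (subst sum.remove[of _ v]) auto
    moreover have "flux d {v} = flux d B" using assms v by (auto simp: flux_def)
    ultimately show ?thesis by simp
  next
    case False
    then have "flux d {u} = 0" if "u \<in> B" for u using that by (auto simp: flux_def)
    moreover have "flux d B = 0" using False by (auto simp: flux_def)
    ultimately show ?thesis using that by simp
  qed
  show "(\<Sum>v\<in>B. \<bar>flux d {v}\<bar>) = \<bar>flux d B\<bar>" by (rule *) simp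
  show "(\<Sum>v\<in>B. max 0 (t * flux d {v})) = max 0 (t * flux d B)" by (rule *) simp
qed

definition inside :: "'e set \<Rightarrow> ('e \<Rightarrow> 'v \<times> 'v) \<Rightarrow> 'v set \<Rightarrow> 'e set" where
  "inside E g A = {e \<in> E. fst (g e) \<in> A \<and> snd (g e) \<in> A}"

text \<open>Once the edges outside \<open>A\<close> are oriented, those meeting \<open>A\<close> become root edges.\<close>
lemma restrict:
  fixes s :: "'e \<Rightarrow> int"
  assumes k: "k > 0" and v: "rooted k W E g c P Q" and A: "A \<subseteq> W"
    and s: "\<forall>e\<in>E. s e = 1 \<or> s e = -1"
    and tot: "2 * k dvd (\<Sum>e\<in>E. s e * flux (g e) A) - sum c A"
    and root: "root_bounded k (sum P A + (\<Sum>e\<in>E. max 0 (- (s e * flux (g e) A))))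
                        (sum Q A + (\<Sum>e\<in>E. max 0 (s e * flux (g e) A)))"
    and inner: "\<And>c' P' Q'. rooted k A (inside E g A) g c' P' Q' \<Longrightarrow>
       (\<And>B. B \<subseteq> A \<Longrightarrow> demand c' P' Q' B = demand c P Q B) \<Longrightarrow>
       (\<And>B. B \<subseteq> A \<Longrightarrow> rcut (inside E g A) g P' Q' B = rcut E g P Q B) \<Longrightarrow> orientable k A (inside E g A) g c'"
  shows "\<exists>s'. (\<forall>e\<in>E. s' e = 1 \<or> s' e = (-1::int)) \<and> (\<forall>e\<in>E - inside E g A. s' e = s e) \<and>
     (\<forall>v\<in>A. 2 * k dvd (\<Sum>e\<in>E. s' e * flux (g e) {v}) - c v)"
proof -
  let ?I = "inside E g A"
  define F where "F = E - ?I"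
  define x where "x = (\<lambda>e v. s e * flux (g e) {v})"
  \<comment> \<open>The edges in \<open>F\<close> are settled, so their contribution leaves
    \<open>c\<close>. An edge with \<open>x e v = -1\<close> enters \<open>v\<close> and becomes an
    arc from the root, one with \<open>x e v = 1\<close> an arc to the root; the demands therefore
    do not change.\<close>
  define c' where "c' = (\<lambda>v. c v - (\<Sum>e\<in>F. x e v))"
  define P' where "P' = (\<lambda>v. P v + (\<Sum>e\<in>F. max 0 (- x e v)))"
  define Q' where "Q' = (\<lambda>v. Q v + (\<Sum>e\<in>F. max 0 (x e v)))"
  have fin: "finite W" "finite E" "finite A" "finite F" "finite ?I"
    using v A finite_subset[OF A] by (auto simp: rooted_def F_def inside_def)
  have E: "E = F \<union> ?I" "F \<inter> ?I = {}" by (auto simp: F_def inside_def)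
  have split: "sum h E = sum h F + sum h ?I" for h :: "'e \<Rightarrow> int"
    using sum.union_disjoint[OF fin(4,5) E(2), of h] E(1) by simp
  have F: "\<not> (fst (g e) \<in> A \<and> snd (g e) \<in> A)" if "e \<in> F" for e
    using that by (auto simp: F_def inside_def)
  have sF: "s e = 1 \<or> s e = -1" if "e \<in> F" for e using s that by (auto simp: F_def)
  have bI: "flux (g e) A = 0" if "e \<in> ?I" for e using that by (auto simp: inside_def flux_def)
  have d: "demand c' P' Q' B = demand c P Q B" if "B \<subseteq> A" for B
  proof -
    have "c' v - P' v + Q' v = c v - P v + Q v" for v
    proof -
      have "(\<Sum>e\<in>F. max 0 (x e v)) - (\<Sum>e\<in>F. max 0 (- x e v)) = (\<Sum>e\<in>F. x e v)"
        unfolding sum_subtractf[symmetric] by (rule sum.cong) auto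
      then show ?thesis by (simp add: c'_def P'_def Q'_def)
    qed
    then show ?thesis by (simp add: demand_def)
  qed
  have D: "rcut ?I g P' Q' B = rcut E g P Q B" if B: "B \<subseteq> A" for B
  proof -
    have fB: "finite B" using B fin(3) finite_subset by blast
    have "(\<Sum>v\<in>B. P' v + Q' v) = (\<Sum>v\<in>B. P v + Q v) + (\<Sum>v\<in>B. \<Sum>e\<in>F. \<bar>flux (g e) {v}\<bar>)"
    proof -
      have "P' v + Q' v = (P v + Q v) + (\<Sum>e\<in>F. \<bar>flux (g e) {v}\<bar>)" for v
      proof -
        have "(\<Sum>e\<in>F. max 0 (- x e v)) + (\<Sum>e\<in>F. max 0 (x e v)) = (\<Sum>e\<in>F. \<bar>flux (g e) {v}\<bar>)"
          unfolding sum.distrib[symmetric] by (rule sum.cong) (use sF in \<open>force simp: x_def\<close>)+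
        then show ?thesis by (simp add: P'_def Q'_def)
      qed
      then show ?thesis by (simp add: sum.distrib)
    qed
    also have "(\<Sum>v\<in>B. \<Sum>e\<in>F. \<bar>flux (g e) {v}\<bar>) = (\<Sum>e\<in>F. \<bar>flux (g e) B\<bar>)"
      by (subst sum.swap) (use flux_union_singletons(1)[OF fB B F] in \<open>simp\<close>)
    finally show ?thesis by (simp add: rcut_def split)
  qed
  have sumF: "sum (\<lambda>v. \<Sum>e\<in>F. max 0 (t * x e v)) A = (\<Sum>e\<in>E. max 0 (t * (s e * flux (g e) A)))" for t
  proof -
    have "sum (\<lambda>v. \<Sum>e\<in>F. max 0 (t * x e v)) A = (\<Sum>e\<in>F. \<Sum>v\<in>A. max 0 ((t * s e) * flux (g e) {v}))"
      by (subst sum.swap) (simp add: x_def mult.assoc)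
    also have "\<dots> = (\<Sum>e\<in>F. max 0 ((t * s e) * flux (g e) A))"
      by (rule sum.cong[OF refl], rule flux_union_singletons(2)[OF fin(3) subset_refl]) (use F in blast)
    finally show ?thesis by (simp add: split bI mult.assoc)
  qed
  have sx: "(\<Sum>v\<in>A. \<Sum>e\<in>F. x e v) = (\<Sum>e\<in>E. s e * flux (g e) A)"
    by (subst sum.swap) (simp add: x_def split bI fin(3) sum_flux flip: sum_distrib_left)
  have val: "rooted k A ?I g c' P' Q'"
    unfolding rooted_def
  proof (intro conjI ballI)
    show "finite A" "finite ?I" by fact+
    show "fst (g e) \<in> A" "snd (g e) \<in> A" if "e \<in> ?I" for e using that by (auto simp: inside_def)
    show "0 \<le> P' u" "0 \<le> Q' u" if "u \<in> A" for u
      using v that A by (auto simp: P'_def Q'_def rooted_def intro!: add_nonneg_nonneg sum_nonneg)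
    have "sum c' A = sum c A - (\<Sum>e\<in>E. s e * flux (g e) A)"
      by (simp add: c'_def sum_subtractf sx)
    then show "2 * k dvd sum c' A" using tot dvd_diff_commute by metis
    show "even (c' u - (\<Sum>e\<in>?I. flux (g e) {u}))" if u: "u \<in> A" for u
    proof -
      have "even (c u - (\<Sum>e\<in>E. flux (g e) {u}))" using v u A by (auto simp: rooted_def)
      moreover have "even (\<Sum>e\<in>F. flux (g e) {u} - x e u)"
        by (rule dvd_sum) (use sF in \<open>force simp: x_def\<close>)
      ultimately have "even ((c u - (\<Sum>e\<in>E. flux (g e) {u})) + (\<Sum>e\<in>F. flux (g e) {u} - x e u))"
        by (rule dvd_add)
      then show ?thesis by (simp add: c'_def split sum_subtractf algebra_simps)
    qed
    show "root_bounded k (sum P' A) (sum Q' A)"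
      using root sumF[of "-1"] sumF[of 1] by (simp add: P'_def Q'_def sum.distrib)
  qed
  obtain s1 where s1: "\<forall>e\<in>?I. s1 e = 1 \<or> s1 e = (-1::int)"
    "\<forall>v\<in>A. 2 * k dvd (\<Sum>e\<in>?I. s1 e * flux (g e) {v}) - c' v"
    using inner[OF val d D] unfolding orientable_def by blast
  define s' where "s' = (\<lambda>e. if e \<in> ?I then s1 e else s e)"
  have "2 * k dvd (\<Sum>e\<in>E. s' e * flux (g e) {v}) - c v" if "v \<in> A" for v
  proof -
    have "(\<Sum>e\<in>F. s' e * flux (g e) {v}) = (\<Sum>e\<in>F. x e v)"
      by (rule sum.cong) (auto simp: s'_def x_def F_def)
    moreover have "(\<Sum>e\<in>?I. s' e * flux (g e) {v}) = (\<Sum>e\<in>?I. s1 e * flux (g e) {v})"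
      by (rule sum.cong) (auto simp: s'_def)
    ultimately have "(\<Sum>e\<in>E. s' e * flux (g e) {v}) - c v = (\<Sum>e\<in>?I. s1 e * flux (g e) {v}) - c' v"
      by (simp add: split c'_def)
    then show ?thesis using s1 that by simp
  qed
  then show ?thesis using s1(1) s by (intro exI[of _ s']) (auto simp: s'_def)
qed

text \<open>Contraction keeps a representative \<open>a\<close> of \<open>A\<close> as the new
  vertex, so the vertex type and the edge set stay the same; edges inside \<open>A\<close> turn into
  loops, which carry no flux.\<close>

definition collapse :: "'v set \<Rightarrow> 'v \<Rightarrow> 'v \<Rightarrow> 'v" where
  "collapse A a v = (if v \<in> A then a else v)"

definition uncollapse :: "'v set \<Rightarrow> 'v \<Rightarrow> 'v set \<Rightarrow> 'v set" where
  "uncollapse A a B = (if a \<in> B then B \<union> A else B)"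

lemma flux_collapse:
  assumes "a \<in> A" "B \<subseteq> insert a (W - A)"
  shows "flux (map_prod (collapse A a) (collapse A a) d) B = flux d (uncollapse A a B)"
  using assms by (auto simp: flux_def collapse_def uncollapse_def)

lemma sum_uncollapse:
  fixes h :: "'v \<Rightarrow> int"
  assumes "finite W" "A \<subseteq> W" "a \<in> A" "B \<subseteq> insert a (W - A)"
  shows "sum (h(a := sum h A)) B = sum h (uncollapse A a B)"
proof (cases "a \<in> B")
  case True
  have fin: "finite B" "finite A" using assms finite_subset[of B "insert a (W - A)"] finite_subset[of A W] by auto
  have "sum (h(a := sum h A)) B = sum h A + sum (h(a := sum h A)) (B - {a})"
    using True fin by (simp add: sum.remove)
  also have "sum (h(a := sum h A)) (B - {a}) = sum h (B - {a})" by (rule sum.cong) auto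
  also have "sum h A + sum h (B - {a}) = sum h (A \<union> (B - {a}))"
    by (rule sum.union_disjoint[symmetric]) (use fin assms in auto)
  also have "A \<union> (B - {a}) = uncollapse A a B" using True assms by (auto simp: uncollapse_def)
  finally show ?thesis .
qed (auto simp: uncollapse_def intro!: sum.cong)

lemma contract_rcut:
  assumes "finite W" "A \<subseteq> W" "a \<in> A" "B \<subseteq> insert a (W - A)"
  shows "rcut E (map_prod (collapse A a) (collapse A a) \<circ> g) (P(a := sum P A)) (Q(a := sum Q A)) B = rcut E g P Q (uncollapse A a B)"
  by (simp add: rcut_def sum.distrib sum_uncollapse[OF assms] flux_collapse[OF assms(3,4)] del: fun_upd_apply)

lemma contract_demand:
  assumes "finite W" "A \<subseteq> W" "a \<in> A" "B \<subseteq> insert a (W - A)"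
  shows "demand (c(a := sum c A)) (P(a := sum P A)) (Q(a := sum Q A)) B = demand c P Q (uncollapse A a B)"
  by (simp add: demand_sum sum_uncollapse[OF assms] del: fun_upd_apply)

lemma uncollapse_self: "A \<subseteq> W \<Longrightarrow> a \<in> A \<Longrightarrow> uncollapse A a (insert a (W - A)) = W"
  by (auto simp: uncollapse_def)

lemma contract_rooted:
  assumes v: "rooted k W E g c P Q" and A: "A \<subseteq> W" "a \<in> A"
  shows "rooted k (insert a (W - A)) E (map_prod (collapse A a) (collapse A a) \<circ> g)
     (c(a := sum c A)) (P(a := sum P A)) (Q(a := sum Q A))"
proof -
  have fin: "finite W" "finite A" using v A finite_subset by (auto simp: rooted_def)
  have S: "sum (h(a := sum h A)) (insert a (W - A)) = sum h W" for h :: "'a \<Rightarrow> int"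
    using sum_uncollapse[OF fin(1) A subset_refl] uncollapse_self[OF A] by metis
  have par: "even (sum c B - (\<Sum>e\<in>E. flux (g e) B))" if "B \<subseteq> W" for B
  proof -
    have "finite B" using fin that finite_subset by blast
    then have "sum c B - (\<Sum>e\<in>E. flux (g e) B) = (\<Sum>v\<in>B. c v - (\<Sum>e\<in>E. flux (g e) {v}))"
      by (subst sum_subtractf, subst sum.swap) (simp add: sum_flux)
    also have "even \<dots>" using v that by (intro dvd_sum) (auto simp: rooted_def)
    finally show ?thesis .
  qed
  show ?thesis
    unfolding rooted_def
  proof (intro conjI ballI)
    show "finite (insert a (W - A))" "finite E" using fin v by (auto simp: rooted_def)
    show "fst ((map_prod (collapse A a) (collapse A a) \<circ> g) e) \<in> insert a (W - A)"
      "snd ((map_prod (collapse A a) (collapse A a) \<circ> g) e) \<in> insert a (W - A)" if "e \<in> E" for e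
      using v that by (auto simp: rooted_def collapse_def)
    show "0 \<le> (P(a := sum P A)) u" "0 \<le> (Q(a := sum Q A)) u" if "u \<in> insert a (W - A)" for u
      using v A that by (auto simp: rooted_def intro!: sum_nonneg)
    show "2 * k dvd sum (c(a := sum c A)) (insert a (W - A))" unfolding S using v by (simp add: rooted_def)
    show "even ((c(a := sum c A)) u - (\<Sum>e\<in>E. flux ((map_prod (collapse A a) (collapse A a) \<circ> g) e) {u}))"
      if u: "u \<in> insert a (W - A)" for u
    proof -
      have "(c(a := sum c A)) u = sum c (uncollapse A a {u})"
        using sum_uncollapse[OF fin(1) A, of "{u}" c] u by simp
      moreover have "uncollapse A a {u} \<subseteq> W" using u A by (auto simp: uncollapse_def)
      ultimately show ?thesis using par u flux_collapse[OF A(2), of "{u}" W] by simp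
    qed
    show "root_bounded k (sum (P(a := sum P A)) (insert a (W - A))) (sum (Q(a := sum Q A)) (insert a (W - A)))"
      unfolding S using v by (simp add: rooted_def)
  qed
qed

text \<open>A tight set is contracted first; afterwards its complement serves as the root.\<close>
lemma tight_reduce:
  assumes k: "k \<ge> 3" and v: "rooted k W E g c P Q" and A: "A \<subseteq> W" "a \<in> A"
    and tight: "rcut E g P Q A = 4 * k - 4 + mod_norm k (demand c P Q A)"
    and outer: "orientable k (insert a (W - A)) E (map_prod (collapse A a) (collapse A a) \<circ> g) (c(a := sum c A))"
    and inner: "\<And>c' P' Q'. rooted k A (inside E g A) g c' P' Q' \<Longrightarrow>
       sum P' A + sum Q' A = rcut E g P Q A \<Longrightarrow>
       (\<And>B. B \<subseteq> A \<Longrightarrow> demand c' P' Q' B = demand c P Q B) \<Longrightarrow>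
       (\<And>B. B \<subseteq> A \<Longrightarrow> rcut (inside E g A) g P' Q' B = rcut E g P Q B) \<Longrightarrow> orientable k A (inside E g A) g c'"
  shows "orientable k W E g c"
proof -
  have fin: "finite W" "finite E" using v by (auto simp: rooted_def)
  obtain s where s: "\<forall>e\<in>E. s e = 1 \<or> s e = (-1::int)"
    and sv: "\<And>v. v \<in> insert a (W - A) \<Longrightarrow>
       2 * k dvd (\<Sum>e\<in>E. s e * flux ((map_prod (collapse A a) (collapse A a) \<circ> g) e) {v}) - (c(a := sum c A)) v"
    using outer unfolding orientable_def by blast
  have out: "2 * k dvd (\<Sum>e\<in>E. s e * flux (g e) {v}) - c v" if "v \<in> W - A" for v
  proof -
    have "v \<noteq> a" using that A by blast
    then show ?thesis using sv[of v] that flux_collapse[OF A(2), of "{v}" W] by (simp add: uncollapse_def)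
  qed
  have "uncollapse A a {a} = A" using A by (auto simp: uncollapse_def)
  then have tot: "2 * k dvd (\<Sum>e\<in>E. s e * flux (g e) A) - sum c A"
    using sv[of a] flux_collapse[OF A(2), of "{a}" W] by simp
  \<comment> \<open>\<open>?p\<close> and \<open>?q\<close> are the outdegree and indegree of the
    root obtained by contracting the complement of \<open>A\<close>. They add up to the cut of
    \<open>A\<close>, and \<open>?p - ?q\<close> is congruent to minus the demand of
    \<open>A\<close>, so tightness is just what \<open>tight_root_bounded\<close> asks.\<close>
  let ?p = "sum P A + (\<Sum>e\<in>E. max 0 (- (s e * flux (g e) A)))"
  let ?q = "sum Q A + (\<Sum>e\<in>E. max 0 (s e * flux (g e) A))"
  have "(\<Sum>e\<in>E. max 0 (- (s e * flux (g e) A))) + (\<Sum>e\<in>E. max 0 (s e * flux (g e) A)) = (\<Sum>e\<in>E. \<bar>flux (g e) A\<bar>)"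
    unfolding sum.distrib[symmetric] by (rule sum.cong) (use s in force)+
  then have pq: "?p + ?q = rcut E g P Q A" by (simp add: rcut_def sum.distrib)
  have "(\<Sum>e\<in>E. max 0 (s e * flux (g e) A)) - (\<Sum>e\<in>E. max 0 (- (s e * flux (g e) A))) = (\<Sum>e\<in>E. s e * flux (g e) A)"
    unfolding sum_subtractf[symmetric] by (rule sum.cong) auto
  then have "- demand c P Q A - (?p - ?q) = (\<Sum>e\<in>E. s e * flux (g e) A) - sum c A" by (simp add: demand_sum)
  then have "mod_norm k (- demand c P Q A) = mod_norm k (?p - ?q)" using tot by (intro mod_norm_cong) simp
  then have mod_norm: "mod_norm k (demand c P Q A) = mod_norm k (?p - ?q)" using mod_norm_uminus k by simp
  have nonneg: "sum P A \<ge> 0" "sum Q A \<ge> 0" using v A by (auto simp: rooted_def intro!: sum_nonneg)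
  have root: "root_bounded k ?p ?q"
    using pq tight mod_norm k nonneg by (intro tight_root_bounded) (auto intro!: add_nonneg_nonneg sum_nonneg)
  \<comment> \<open>The signs inside \<open>A\<close> were arbitrary so far, those edges being loops
    in the contracted instance; now they are chosen anew.\<close>
  have "\<exists>s'. (\<forall>e\<in>E. s' e = 1 \<or> s' e = (-1::int)) \<and> (\<forall>e\<in>E - inside E g A. s' e = s e) \<and>
     (\<forall>v\<in>A. 2 * k dvd (\<Sum>e\<in>E. s' e * flux (g e) {v}) - c v)"
  proof (rule restrict[OF _ v A(1) s tot root])
    fix c' P' Q'
    assume 1: "rooted k A (inside E g A) g c' P' Q'" "\<And>B. B \<subseteq> A \<Longrightarrow> demand c' P' Q' B = demand c P Q B"
       "\<And>B. B \<subseteq> A \<Longrightarrow> rcut (inside E g A) g P' Q' B = rcut E g P Q B"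
    have "flux (g e) A = 0" if "e \<in> inside E g A" for e using that by (auto simp: inside_def flux_def)
    then have "rcut (inside E g A) g P' Q' A = sum P' A + sum Q' A"
      by (simp add: rcut_def sum.distrib)
    then show "orientable k A (inside E g A) g c'" using inner 1 by simp
  qed (use k in simp)
  then obtain s' where s': "\<forall>e\<in>E. s' e = 1 \<or> s' e = (-1::int)" "\<forall>e\<in>E - inside E g A. s' e = s e"
     "\<forall>v\<in>A. 2 * k dvd (\<Sum>e\<in>E. s' e * flux (g e) {v}) - c v" by blast
  have "2 * k dvd (\<Sum>e\<in>E. s' e * flux (g e) {v}) - c v" if "v \<in> W" for v
  proof (cases "v \<in> A")
    case False
    have "s' e * flux (g e) {v} = s e * flux (g e) {v}" if "e \<in> E" for e
    proof (cases "e \<in> inside E g A")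
      case True
      then have "flux (g e) {v} = 0" using False by (auto simp: inside_def flux_def)
      then show ?thesis by simp
    qed (use s'(2) that in auto)
    then have "(\<Sum>e\<in>E. s' e * flux (g e) {v}) = (\<Sum>e\<in>E. s e * flux (g e) {v})" by (rule sum.cong[OF refl])
    then show ?thesis using out False that by simp
  qed (use s' in blast)
  then show ?thesis using s'(1) unfolding orientable_def by blast
qed

section \<open>Splitting off a vertex of demand zero\<close>

definition joins :: "'v \<times> 'v \<Rightarrow> 'v \<Rightarrow> 'v \<Rightarrow> bool" where
  "joins d x y \<longleftrightarrow> d = (x, y) \<or> d = (y, x)"

lemma flux_joins: "joins d x y \<Longrightarrow> \<exists>t\<in>{1, -1}. \<forall>A. flux d A = t * (of_bool (x \<in> A) - of_bool (y \<in> A))"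
  by (auto simp: joins_def flux_def)

lemma flux_pair [simp]: "flux (a, b) A = of_bool (a \<in> A) - of_bool (b \<in> A)"
  by (simp add: flux_def)

lemma abs_flux_joins: "joins d x y \<Longrightarrow> \<bar>flux d A\<bar> = of_bool ((x \<in> A) \<noteq> (y \<in> A))"
  by (auto simp: joins_def flux_def)

lemma obtain_joins:
  assumes "rooted k W E g c P Q" "e \<in> E" "flux (g e) {x} \<noteq> 0"
  obtains y where "joins (g e) x y" "y \<noteq> x" "y \<in> W" "x \<in> W"
proof -
  have W: "fst (g e) \<in> W" "snd (g e) \<in> W" using assms by (auto simp: rooted_def)
  show ?thesis
  proof (cases "fst (g e) = x")
    case True
    then show ?thesis using W assms(3) that[of "snd (g e)"]
      by (cases "g e") (auto simp: joins_def flux_def split: if_splits)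
  next
    case False
    then show ?thesis using W assms(3) that[of "fst (g e)"]
      by (cases "g e") (auto simp: joins_def flux_def split: if_splits)
  qed
qed

text \<open>The edge is oriented from \<open>u\<close> to \<open>v\<close>, which already supplies 1
  to the net outdegree of \<open>u\<close> and -1 to that of \<open>v\<close>.\<close>

lemma orientable_delete:
  assumes "finite E" "e \<in> E" "joins (g e) u v" "u \<noteq> v"
    and sol: "orientable k W (E - {e}) g (c(u := c u - 1, v := c v + 1))"
  shows "orientable k W E g c"
proof -
  obtain t where t: "t \<in> {1, -1}" "\<And>A. flux (g e) A = t * (of_bool (u \<in> A) - of_bool (v \<in> A))"
    using flux_joins[OF assms(3)] by blast
  obtain s where s: "\<forall>e\<in>E - {e}. s e = 1 \<or> s e = (-1::int)"
    "\<forall>w\<in>W. 2 * k dvd (\<Sum>e\<in>E - {e}. s e * flux (g e) {w}) - (c(u := c u - 1, v := c v + 1)) w"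
    using sol unfolding orientable_def by blast
  let ?s = "s(e := t)"
  have "(\<Sum>e\<in>E. ?s e * flux (g e) {w}) - c w =
     (\<Sum>e\<in>E - {e}. s e * flux (g e) {w}) - (c(u := c u - 1, v := c v + 1)) w" for w
  proof -
    have "(\<Sum>e\<in>E. ?s e * flux (g e) {w}) = t * flux (g e) {w} + (\<Sum>e\<in>E - {e}. s e * flux (g e) {w})"
      using assms by (simp add: sum.remove[of E e])
    moreover have "t * flux (g e) {w} = of_bool (u = w) - of_bool (v = w)" using t by auto
    ultimately show ?thesis using \<open>u \<noteq> v\<close> by auto
  qed
  then show ?thesis unfolding orientable_def
    by (intro exI[of _ ?s]) (use s t in auto)
qed

lemma rooted_delete:
  assumes v: "rooted k W E g c P Q" and e: "e \<in> E" "joins (g e) u v" "u \<noteq> v"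
    and PQ: "\<forall>v\<in>W. 0 \<le> P' v \<and> 0 \<le> Q' v" "root_bounded k (sum P' W) (sum Q' W)"
  shows "rooted k W (E - {e}) g (c(u := c u - 1, v := c v + 1)) P' Q'"
proof -
  have W: "u \<in> W" "v \<in> W" using v e by (auto simp: rooted_def joins_def)
  have fin: "finite W" "finite E" using v by (auto simp: rooted_def)
  obtain t where t: "t \<in> {1, -1}" "\<And>A. flux (g e) A = t * (of_bool (u \<in> A) - of_bool (v \<in> A))"
    using flux_joins[OF e(2)] by blast
  have "even ((c(u := c u - 1, v := c v + 1)) w - (\<Sum>e\<in>E - {e}. flux (g e) {w}))" if "w \<in> W" for w
  proof -
    have "even (c w - (\<Sum>e\<in>E. flux (g e) {w}))" using v that by (auto simp: rooted_def)
    then show ?thesis using t(1) e(3) unfolding sum.remove[OF fin(2) e(1)] t(2) by auto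
  qed
  moreover have "sum (c(u := c u - 1, v := c v + 1)) W = sum c W"
  proof -
    have "sum (c(u := c u - 1, v := c v + 1)) W = sum (\<lambda>w. c w - of_bool (w = u) + of_bool (w = v)) W"
      using e(3) by (intro sum.cong) auto
    also have "\<dots> = sum c W" using W fin by (simp add: sum.distrib sum_subtractf of_bool_def)
    finally show ?thesis .
  qed
  ultimately show ?thesis using v PQ by (auto simp: rooted_def)
qed

lemma cut_delete:
  assumes "finite E" "e \<in> E" "joins (g e) u v"
  shows "(\<Sum>e\<in>E - {e}. \<bar>flux (g e) A\<bar>) = (\<Sum>e\<in>E. \<bar>flux (g e) A\<bar>) - of_bool ((u \<in> A) \<noteq> (v \<in> A))"
  using sum.remove[OF assms(1,2), of "\<lambda>e. \<bar>flux (g e) A\<bar>"] abs_flux_joins[OF assms(3), of A] by simp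

lemma sum_upd2:
  fixes h :: "'v \<Rightarrow> int"
  assumes "finite A" "u \<noteq> v"
  shows "sum (h(u := h u + p, v := h v + q)) A = sum h A + p * of_bool (u \<in> A) + q * of_bool (v \<in> A)"
proof -
  have "sum (h(u := h u + p, v := h v + q)) A = sum (\<lambda>w. h w + (if w = u then p else 0) + (if w = v then q else 0)) A"
    using assms by (intro sum.cong) auto
  also have "\<dots> = sum h A + p * of_bool (u \<in> A) + q * of_bool (v \<in> A)"
    using assms by (simp add: sum.distrib)
  finally show ?thesis .
qed

lemma sum_upd1:
  fixes h :: "'v \<Rightarrow> int"
  assumes "finite A"
  shows "sum (h(u := h u + p)) A = sum h A + p * of_bool (u \<in> A)"
proof -
  have "sum (h(u := h u + p)) A = sum (\<lambda>w. h w + (if w = u then p else 0)) A"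
    by (intro sum.cong) auto
  also have "\<dots> = sum h A + p * of_bool (u \<in> A)"
    using assms by (simp add: sum.distrib)
  finally show ?thesis .
qed

text \<open>The path from the root through \<open>x\<close> to \<open>y\<close> is replaced by one
  arc from the root to \<open>y\<close>. No demand changes, and only the cuts of sets with
  \<open>x\<close> inside and \<open>y\<close> outside lose the two edges of the path.\<close>

lemma root_lift:
  assumes v: "rooted k W E g c P Q" and e: "e \<in> E" "joins (g e) x y" "x \<noteq> y" and P: "P x > 0"
  defines "c' \<equiv> c(x := c x - 1, y := c y + 1)" and "P' \<equiv> P(x := P x - 1, y := P y + 1)"
  shows "rooted k W (E - {e}) g c' P' Q"
    and "A \<subseteq> W \<Longrightarrow> demand c' P' Q A = demand c P Q A"
    and "A \<subseteq> W \<Longrightarrow> rcut (E - {e}) g P' Q A = rcut E g P Q A - 2 * of_bool (x \<in> A \<and> y \<notin> A)"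
    and "sum P' W = sum P W"
proof -
  have W: "x \<in> W" "y \<in> W" "finite W" "finite E" using v e by (auto simp: rooted_def joins_def)
  have sP: "sum P' A = sum P A - of_bool (x \<in> A) + of_bool (y \<in> A)"
    and sc: "sum c' A = sum c A - of_bool (x \<in> A) + of_bool (y \<in> A)" if "A \<subseteq> W" for A
    using sum_upd2[OF finite_subset[OF that W(3)] e(3), of P "-1" 1]
      sum_upd2[OF finite_subset[OF that W(3)] e(3), of c "-1" 1] by (simp_all add: P'_def c'_def)
  show PW: "sum P' W = sum P W" using sP[of W] W by simp
  have n: "\<forall>v\<in>W. 0 \<le> P' v \<and> 0 \<le> Q v" using v P by (auto simp: rooted_def P'_def)
  have r: "root_bounded k (sum P' W) (sum Q W)" using v PW by (simp add: rooted_def)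
  show "rooted k W (E - {e}) g c' P' Q" unfolding c'_def using rooted_delete[OF v e n r] .
  show "A \<subseteq> W \<Longrightarrow> demand c' P' Q A = demand c P Q A" by (simp add: demand_sum sP sc)
  show "A \<subseteq> W \<Longrightarrow> rcut (E - {e}) g P' Q A = rcut E g P Q A - 2 * of_bool (x \<in> A \<and> y \<notin> A)"
    unfolding rcut_def sum.distrib
    using cut_delete[where g = g and e = e, OF W(4) e(1,2), of A] sP[of A] by auto
qed

lemma sum_two:
  fixes h :: "'e \<Rightarrow> int"
  assumes "finite E" "e1 \<in> E" "e2 \<in> E" "e1 \<noteq> e2"
  shows "sum h E = h e1 + h e2 + sum h (E - {e1, e2})" "sum h (E - {e2}) = h e1 + sum h (E - {e1, e2})"
proof -
  show 2: "sum h (E - {e2}) = h e1 + sum h (E - {e1, e2})"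
  proof -
    have "E - {e1, e2} = E - {e2} - {e1}" by blast
    then show ?thesis using assms sum.remove[of "E - {e2}" e1 h] by simp
  qed
  show "sum h E = h e1 + h e2 + sum h (E - {e1, e2})"
    using assms sum.remove[of E e2 h] 2 by simp
qed

text \<open>The two edges become a single edge between \<open>y1\<close> and \<open>y2\<close>,
  stored under the name \<open>e1\<close>; if \<open>y1 = y2\<close> it is a loop. An orientation of
  the new edge is read back as a directed path through \<open>x\<close>, which adds nothing to the
  net outdegree of \<open>x\<close>.\<close>

lemma pair_lift:
  assumes v: "rooted k W E g c P Q" and e: "e1 \<in> E" "e2 \<in> E" "e1 \<noteq> e2"
    and j: "joins (g e1) x y1" "joins (g e2) x y2"
  shows "rooted k W (E - {e2}) (g(e1 := (y1, y2))) c P Q"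
    and "rcut (E - {e2}) (g(e1 := (y1, y2))) P Q A = rcut E g P Q A
           - 2 * of_bool ((x \<in> A) \<noteq> (y1 \<in> A) \<and> (x \<in> A) \<noteq> (y2 \<in> A))"
    and "orientable k W (E - {e2}) (g(e1 := (y1, y2))) c \<Longrightarrow> orientable k W E g c"
proof -
  let ?g = "g(e1 := (y1, y2))" and ?F = "E - {e1, e2}"
  have fin: "finite W" "finite E" using v by (auto simp: rooted_def)
  have W: "y1 \<in> W" "y2 \<in> W" using v e j by (auto simp: rooted_def joins_def)
  note two = sum_two[OF fin(2) e]
  have F: "(\<Sum>e\<in>?F. h (?g e)) = (\<Sum>e\<in>?F. h (g e))" for h :: "'a \<times> 'a \<Rightarrow> int" by (rule sum.cong) auto
  obtain t1 where t1: "t1 \<in> {1, -1}" "\<And>A. flux (g e1) A = t1 * (of_bool (x \<in> A) - of_bool (y1 \<in> A))"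
    using flux_joins[OF j(1)] by blast
  obtain t2 where t2: "t2 \<in> {1, -1}" "\<And>A. flux (g e2) A = t2 * (of_bool (x \<in> A) - of_bool (y2 \<in> A))"
    using flux_joins[OF j(2)] by blast
  have "even (c w - (\<Sum>e\<in>E - {e2}. flux (?g e) {w}))" if "w \<in> W" for w
  proof -
    have "even (c w - (\<Sum>e\<in>E. flux (g e) {w}))" using v that by (auto simp: rooted_def)
    moreover have "(\<Sum>e\<in>E. flux (g e) {w}) = flux (g e1) {w} + flux (g e2) {w} + (\<Sum>e\<in>?F. flux (g e) {w})"
      by (rule two(1))
    moreover have "(\<Sum>e\<in>E - {e2}. flux (?g e) {w}) = flux (y1, y2) {w} + (\<Sum>e\<in>?F. flux (g e) {w})"
      using two(2)[of "\<lambda>e. flux (?g e) {w}"] F[of "\<lambda>d. flux d {w}"] by simp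
    moreover have "even (flux (g e1) {w} + flux (g e2) {w} - flux (y1, y2) {w})"
      using t1(1) t2(1) unfolding t1(2) t2(2) by auto
    ultimately show ?thesis by presburger
  qed
  then show "rooted k W (E - {e2}) ?g c P Q" using v W by (auto simp: rooted_def)
  have "(\<Sum>e\<in>E. \<bar>flux (g e) A\<bar>) = \<bar>flux (g e1) A\<bar> + \<bar>flux (g e2) A\<bar> + (\<Sum>e\<in>?F. \<bar>flux (g e) A\<bar>)"
    by (rule two(1))
  moreover have "(\<Sum>e\<in>E - {e2}. \<bar>flux (?g e) A\<bar>) = \<bar>flux (y1, y2) A\<bar> + (\<Sum>e\<in>?F. \<bar>flux (g e) A\<bar>)"
    using two(2)[of "\<lambda>e. \<bar>flux (?g e) A\<bar>"] F[of "\<lambda>d. \<bar>flux d A\<bar>"] by simp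
  ultimately show "rcut (E - {e2}) ?g P Q A = rcut E g P Q A
           - 2 * of_bool ((x \<in> A) \<noteq> (y1 \<in> A) \<and> (x \<in> A) \<noteq> (y2 \<in> A))"
    unfolding rcut_def using abs_flux_joins[OF j(1), of A] abs_flux_joins[OF j(2), of A] by auto
  assume "orientable k W (E - {e2}) ?g c"
  then obtain s where s: "\<forall>e\<in>E - {e2}. s e = 1 \<or> s e = (-1::int)"
    "\<forall>w\<in>W. 2 * k dvd (\<Sum>e\<in>E - {e2}. s e * flux (?g e) {w}) - c w"
    unfolding orientable_def by blast
  \<comment> \<open>The factors \<open>t1\<close> and \<open>t2\<close> undo the reference
    directions: for \<open>s e1 = 1\<close> the path runs from \<open>y1\<close> to \<open>x\<close>
    and on to \<open>y2\<close>.\<close>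
  define s' where "s' = s(e1 := - s e1 * t1, e2 := s e1 * t2)"
  have "(\<Sum>e\<in>E. s' e * flux (g e) {w}) = (\<Sum>e\<in>E - {e2}. s e * flux (?g e) {w})" for w
  proof -
    have "(\<Sum>e\<in>?F. s' e * flux (g e) {w}) = (\<Sum>e\<in>?F. s e * flux (?g e) {w})"
      by (rule sum.cong) (auto simp: s'_def)
    moreover have "s' e1 * flux (g e1) {w} + s' e2 * flux (g e2) {w} = s e1 * flux (y1, y2) {w}"
      using t1(1) t2(1) e(3) unfolding t1(2) t2(2) by (auto simp: s'_def)
    ultimately show ?thesis
      using two(1)[of "\<lambda>e. s' e * flux (g e) {w}"] two(2)[of "\<lambda>e. s e * flux (?g e) {w}"] by simp
  qed
  moreover have "\<forall>e\<in>E. s' e = 1 \<or> s' e = -1" using s(1) t1 t2 e by (auto simp: s'_def)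
  ultimately show "orientable k W E g c" using s(2) unfolding orientable_def by (intro exI[of _ s']) simp
qed

lemma drop_isolated:
  assumes k: "k > 0" and v: "rooted k W E g c P Q" and x: "x \<in> W" "P x = 0" "Q x = 0" "2 * k dvd c x"
    and iso: "\<forall>e\<in>E. flux (g e) {x} = 0"
  shows "rooted k (W - {x}) (inside E g (W - {x})) g c P Q"
    and "x \<notin> A \<Longrightarrow> rcut (inside E g (W - {x})) g P Q A = rcut E g P Q A"
    and "orientable k (W - {x}) (inside E g (W - {x})) g c \<Longrightarrow> orientable k W E g c"
proof -
  let ?E = "inside E g (W - {x})"
  have fin: "finite W" "finite E" using v by (auto simp: rooted_def)
  have loop: "flux (g e) A = 0" if "e \<in> E - ?E" for e A
    using that v iso by (force simp: inside_def rooted_def flux_def split: if_splits)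
  have S: "(\<Sum>e\<in>E. h e) = (\<Sum>e\<in>?E. h e)" if "\<And>e. e \<in> E - ?E \<Longrightarrow> h e = (0::int)" for h
    using fin that by (intro sum.mono_neutral_right) (auto simp: inside_def)
  have sW: "sum h W = h x + sum h (W - {x})" for h :: "'a \<Rightarrow> int" using fin x by (simp add: sum.remove)
  have "2 * k dvd sum c (W - {x})"
    using v x(4) by (simp add: rooted_def sW dvd_add_right_iff)
  moreover have "even (c w - (\<Sum>e\<in>?E. flux (g e) {w}))" if "w \<in> W" for w
    using v that S[of "\<lambda>e. flux (g e) {w}"] loop by (simp add: rooted_def)
  ultimately show "rooted k (W - {x}) ?E g c P Q"
    using v x fin by (auto simp: rooted_def sW inside_def)
  show "x \<notin> A \<Longrightarrow> rcut ?E g P Q A = rcut E g P Q A"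
    using S[of "\<lambda>e. \<bar>flux (g e) A\<bar>"] loop by (simp add: rcut_def)
  assume "orientable k (W - {x}) ?E g c"
  then obtain s where s: "\<forall>e\<in>?E. s e = 1 \<or> s e = (-1::int)"
    "\<forall>w\<in>W - {x}. 2 * k dvd (\<Sum>e\<in>?E. s e * flux (g e) {w}) - c w"
    unfolding orientable_def by blast
  \<comment> \<open>The edges outside \<open>?E\<close> are loops at \<open>x\<close>, so the
    default sign 1 does no harm.\<close>
  define s' where "s' = (\<lambda>e. if e \<in> ?E then s e else 1)"
  have "(\<Sum>e\<in>E. s' e * flux (g e) {w}) = (\<Sum>e\<in>?E. s e * flux (g e) {w})" for w
    using S[of "\<lambda>e. s' e * flux (g e) {w}"] loop by (simp add: s'_def)
  moreover have "(\<Sum>e\<in>?E. s e * flux (g e) {x}) = 0"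
    by (rule sum.neutral) (auto simp: inside_def flux_def)
  ultimately have "2 * k dvd (\<Sum>e\<in>E. s' e * flux (g e) {w}) - c w" if "w \<in> W" for w
    using s(2) x(4) that by (cases "w = x") simp_all
  then show "orientable k W E g c" unfolding orientable_def
    by (intro exI[of _ s'] conjI ballI) (use s(1) in \<open>auto simp: s'_def\<close>)
qed

lemma flux_compl:
  assumes "fst d \<in> A" "snd d \<in> A" "x \<in> A"
  shows "flux d (A - {x}) = - flux d {x}"
  using assms by (auto simp: flux_def)

lemma uncollapse_proper:
  assumes "A \<subseteq> W" "a \<in> A" "B \<subseteq> insert a (W - A)" "B \<noteq> {}" "B \<noteq> insert a (W - A)"
  shows "uncollapse A a B \<subseteq> W" "uncollapse A a B \<noteq> {}" "uncollapse A a B \<noteq> W"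
proof -
  show "uncollapse A a B \<subseteq> W" "uncollapse A a B \<noteq> {}" using assms by (auto simp: uncollapse_def)
  obtain u where u: "u \<in> insert a (W - A)" "u \<notin> B" using assms by blast
  show "uncollapse A a B \<noteq> W"
  proof (cases "a \<in> B")
    case True
    then show ?thesis using u by (auto simp: uncollapse_def)
  qed (use assms in \<open>auto simp: uncollapse_def\<close>)
qed

lemma zero_split:
  fixes W :: "'v set" and E :: "'e set"
  assumes k: "k \<ge> 3"
    and IH: "\<And>(W :: 'v set) (E :: 'e set) g c P Q. rooted k W E g c P Q \<Longrightarrow> cut_condition k W E g c P Q {} \<Longrightarrow>
        W \<noteq> {} \<Longrightarrow> card W < n \<Longrightarrow> orientable k W E g c"
    and "rooted k W E g c P Q" "x \<in> W" "card W \<le> n" "2 \<le> card W" "2 * k dvd c x - P x + Q x"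
    and "cut_condition k W E g c P Q {{x}, W - {x}}"
    and "\<bar>P x - Q x\<bar> \<le> (\<Sum>e\<in>E. \<bar>flux (g e) {x}\<bar>)"
  shows "orientable k W E g c"
  using assms(3-)
\<comment> \<open>Contractions lower the number of vertices; lifting and cancelling keep it and
  lower the number of edges, root edges included.\<close>
proof (induction "(card W, card E + nat (sum P W + sum Q W))" arbitrary: W E g c P Q x
    rule: wf_induct[OF wf_lex_prod[OF wf_less_than wf_less_than]])
  case (1 W E P Q g c x)
  note v = 1(2) and x = 1(3) and n = 1(4) and W2 = 1(5) and zx = 1(6) and wd = 1(7) and wx = 1(8)
  have hyp: "orientable k W' E' g' c'"
    if "card W' < card W \<or> card W' = card W \<and> card E' + nat (sum P' W' + sum Q' W') < card E + nat (sum P W + sum Q W)"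
      "rooted k W' E' g' c' P' Q'" "x' \<in> W'" "2 \<le> card W'" "2 * k dvd c' x' - P' x' + Q' x'"
      "cut_condition k W' E' g' c' P' Q' {{x'}, W' - {x'}}"
      "\<bar>P' x' - Q' x'\<bar> \<le> (\<Sum>e\<in>E'. \<bar>flux (g' e) {x'}\<bar>)" for W' :: "'v set" and E' :: "'e set" and g' c' P' Q' x'
  proof -
    have "card W' \<le> n" using that(1) n by auto
    then show ?thesis using 1(1)[rule_format, OF _ refl that(2,3) _ that(4-7)] that(1) by simp
  qed
  let ?X = "{{x}, W - {x}}"
  have fin: "finite W" "finite E" using v by (auto simp: rooted_def)
  have k0: "k > 0" using k by simp
  have ndW: "mod_norm k (demand c P Q (insert x B)) = mod_norm k (demand c P Q B)" if "B \<subseteq> W" "x \<notin> B" for B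
    using zx that fin finite_subset[OF that(1) fin(1)] by (intro mod_norm_cong) (simp add: demand_def)
  show ?case
  proof (cases "\<exists>A. A \<subseteq> W \<and> A \<noteq> W \<and> A \<notin> ?X \<and> 2 \<le> card A \<and> rcut E g P Q A = 4 * k - 4 + mod_norm k (demand c P Q A)")
    case True
    then obtain A where A: "A \<subseteq> W" "A \<noteq> W" "A \<noteq> {x}" "A \<noteq> W - {x}" "2 \<le> card A"
      and tight: "rcut E g P Q A = 4 * k - 4 + mod_norm k (demand c P Q A)" by blast
    have fA: "finite A" using A fin finite_subset by blast
    have cA: "card A < card W" using A fin by (simp add: psubset_card_mono psubset_eq)
    have Ane: "A \<noteq> {}" using A by auto
    obtain a where a: "a \<in> A" "x \<in> A \<Longrightarrow> a = x" using Ane by blast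
    let ?W = "insert a (W - A)"
    have "card ?W = card W - card A + 1" using fin fA A a by (simp add: card_Diff_subset)
    then have cW: "card ?W < card W" using A(5) cA by linarith
    note vc = contract_rooted[OF v A(1) a(1)]
    show ?thesis
    proof (rule tight_reduce[OF k v A(1) a(1) tight])
      show "orientable k ?W E (map_prod (collapse A a) (collapse A a) \<circ> g) (c(a := sum c A))"
      proof (cases "x \<in> A")
        \<comment> \<open>Here no exemption survives: the preimage of a set of the contracted
          instance contains \<open>A\<close> or misses it, so it is neither \<open>{x}\<close> nor
          \<open>W - {x}\<close>.\<close>
        case True
        then have ax: "a = x" using a by simp
        show ?thesis
        proof (rule IH[OF vc])
          show "cut_condition k ?W E (map_prod (collapse A a) (collapse A a) \<circ> g) (c(a := sum c A)) (P(a := sum P A)) (Q(a := sum Q A)) {}"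
            unfolding cut_condition_def
          proof (intro allI impI)
            fix B assume B: "B \<subseteq> ?W" "B \<noteq> {}" "B \<noteq> ?W"
            note uncollapse_proper[OF A(1) a(1) B(1-3)]
            moreover have "uncollapse A a B \<noteq> {x}" using B A a True by (auto simp: uncollapse_def ax split: if_splits)
            moreover have "uncollapse A a B \<noteq> W - {x}" using B A a True by (auto simp: uncollapse_def ax split: if_splits)
            ultimately show "4 * k - 4 + mod_norm k (demand (c(a := sum c A)) (P(a := sum P A)) (Q(a := sum Q A)) B)
              \<le> rcut E (map_prod (collapse A a) (collapse A a) \<circ> g) (P(a := sum P A)) (Q(a := sum Q A)) B"
              unfolding contract_rcut[OF fin(1) A(1) a(1) B(1)] contract_demand[OF fin(1) A(1) a(1) B(1)]
              by (intro cut_conditionD[OF wd]) auto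
          qed
        qed (use cW n in auto)
      next
        case False
        have xW: "x \<in> ?W" "x \<noteq> a" using False x a by auto
        show ?thesis
        proof (rule hyp[OF _ vc xW(1)])
          show "cut_condition k ?W E (map_prod (collapse A a) (collapse A a) \<circ> g) (c(a := sum c A)) (P(a := sum P A)) (Q(a := sum Q A)) {{x}, ?W - {x}}"
            unfolding cut_condition_def
          proof (intro allI impI)
            fix B assume B: "B \<subseteq> ?W" "B \<noteq> {}" "B \<noteq> ?W" "B \<notin> {{x}, ?W - {x}}"
            note uncollapse_proper[OF A(1) a(1) B(1-3)]
            moreover have "uncollapse A a B \<noteq> {x}" using B A a False by (auto simp: uncollapse_def split: if_splits)
            moreover have "uncollapse A a B \<noteq> W - {x}" using B A a False xW by (auto simp: uncollapse_def split: if_splits)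
            ultimately show "4 * k - 4 + mod_norm k (demand (c(a := sum c A)) (P(a := sum P A)) (Q(a := sum Q A)) B)
              \<le> rcut E (map_prod (collapse A a) (collapse A a) \<circ> g) (P(a := sum P A)) (Q(a := sum Q A)) B"
              unfolding contract_rcut[OF fin(1) A(1) a(1) B(1)] contract_demand[OF fin(1) A(1) a(1) B(1)]
              by (intro cut_conditionD[OF wd]) auto
          qed
          have "{x, a} \<subseteq> ?W" using xW by auto
          then have "card {x, a} \<le> card ?W" using fin by (intro card_mono) auto
          then show "2 \<le> card ?W" using xW by simp
          have "uncollapse A a {x} = {x}" using xW by (simp add: uncollapse_def)
          then have "flux ((map_prod (collapse A a) (collapse A a) \<circ> g) e) {x} = flux (g e) {x}" for e
            using flux_collapse[OF a(1), of "{x}" W] xW by simp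
          then show "\<bar>(P(a := sum P A)) x - (Q(a := sum Q A)) x\<bar>
             \<le> (\<Sum>e\<in>E. \<bar>flux ((map_prod (collapse A a) (collapse A a) \<circ> g) e) {x}\<bar>)"
            using wx xW by simp
        qed (use cW zx xW in auto)
      qed
    next
      fix c' P' Q'
      assume v': "rooted k A (inside E g A) g c' P' Q'"
        and s': "sum P' A + sum Q' A = rcut E g P Q A"
        and dm: "\<And>B. B \<subseteq> A \<Longrightarrow> demand c' P' Q' B = demand c P Q B"
        and dg: "\<And>B. B \<subseteq> A \<Longrightarrow> rcut (inside E g A) g P' Q' B = rcut E g P Q B"
      show "orientable k A (inside E g A) g c'"
      proof (cases "x \<in> A")
        case False
        have "cut_condition k A (inside E g A) g c' P' Q' {}"
          unfolding cut_condition_def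
        proof (intro allI impI)
          fix B assume B: "B \<subseteq> A" "B \<noteq> {}" "B \<noteq> A"
          have "B \<subseteq> W" "B \<noteq> W" "B \<noteq> {x}" "B \<noteq> W - {x}" using A B False by auto
          then show "4 * k - 4 + mod_norm k (demand c' P' Q' B) \<le> rcut (inside E g A) g P' Q' B"
            using cut_conditionD[OF wd _ B(2)] by (simp add: dm dg B)
        qed
        then show ?thesis using IH[OF v'] Ane cA n by simp
      next
        case True
        have "cut_condition k A (inside E g A) g c' P' Q' {{x}, A - {x}}"
          unfolding cut_condition_def
        proof (intro allI impI)
          fix B assume B: "B \<subseteq> A" "B \<noteq> {}" "B \<noteq> A" "B \<notin> {{x}, A - {x}}"
          have "B \<subseteq> W" "B \<noteq> W" "B \<noteq> {x}" "B \<noteq> W - {x}" using A B True by auto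
          then show "4 * k - 4 + mod_norm k (demand c' P' Q' B) \<le> rcut (inside E g A) g P' Q' B"
            using cut_conditionD[OF wd _ B(2)] by (simp add: dm dg B)
        qed
        moreover have "2 * k dvd c' x - P' x + Q' x"
          using dm[of "{x}"] True zx by (simp add: demand_def)
        moreover have "\<bar>P' x - Q' x\<bar> \<le> (\<Sum>e\<in>inside E g A. \<bar>flux (g e) {x}\<bar>)"
        proof -
          \<comment> \<open>\<open>A - {x}\<close> is not exempt and its demand has the same norm as
            that of the tight set \<open>A\<close>, so its cut is at least as large. Comparing the
            two cuts shows that the new root edges at \<open>x\<close> do not outnumber the edges
            from \<open>x\<close> to the rest of \<open>A\<close>.\<close>
          let ?B = "A - {x}"
          have B: "?B \<subseteq> W" "?B \<noteq> {}" "?B \<noteq> W" "?B \<notin> ?X" 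
            using A True by (auto simp: card_le_Suc0_iff_eq)
          have "insert x ?B = A" using True by blast
          then have "mod_norm k (demand c P Q A) = mod_norm k (demand c P Q ?B)" using ndW[of ?B] B by simp
          then have "rcut E g P Q A \<le> rcut E g P Q ?B" using cut_conditionD[OF wd B] tight by simp
          also have "\<dots> = rcut (inside E g A) g P' Q' ?B" by (rule dg[symmetric]) auto
          also have "\<dots> = (\<Sum>e\<in>inside E g A. \<bar>flux (g e) {x}\<bar>) + (sum P' ?B + sum Q' ?B)"
            unfolding rcut_def sum.distrib
            by (intro arg_cong2[of _ _ _ _ "(+)"] refl sum.cong) (auto simp: inside_def flux_compl True)
          finally have "sum P' A + sum Q' A \<le> (\<Sum>e\<in>inside E g A. \<bar>flux (g e) {x}\<bar>) + (sum P' ?B + sum Q' ?B)"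
            using s' by simp
          then have "P' x + Q' x \<le> (\<Sum>e\<in>inside E g A. \<bar>flux (g e) {x}\<bar>)"
            using fA True by (simp add: sum.remove[of A x])
          moreover have "P' x \<ge> 0" "Q' x \<ge> 0" using v' True by (auto simp: rooted_def)
          ultimately show ?thesis by linarith
        qed
        ultimately show ?thesis using hyp[OF _ v' True A(5)] cA by simp
      qed
    qed
  next
    case False
    \<comment> \<open>Each reduction below costs a cut at most 2, which the slack covers for sets of
      at least two vertices; only singletons need further care.\<close>
    have slack: "4 * k - 2 + mod_norm k (demand c P Q A) \<le> rcut E g P Q A"
      if "A \<subseteq> W" "A \<noteq> W" "A \<notin> ?X" "2 \<le> card A" for A
    proof -
      have "A \<noteq> {}" using that(4) by auto
      moreover have "rcut E g P Q A \<noteq> 4 * k - 4 + mod_norm k (demand c P Q A)" using False that by blast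
      ultimately show ?thesis using slack2[OF k0 v wd that(1) _ that(2,3)] by blast
    qed
    have two: "2 \<le> card A" if "A \<subseteq> W" "u \<in> A" "w \<in> A" "u \<noteq> w" for A u w
    proof -
      have "card {u, w} \<le> card A" using that fin finite_subset by (intro card_mono) auto
      then show ?thesis using that by simp
    qed
    let ?w = "\<lambda>E g. \<Sum>e\<in>E. \<bar>flux (g e) {x}\<bar>"
    \<comment> \<open>A set that loses by \<open>root_lift\<close> contains \<open>x\<close>; since
      \<open>{x}\<close> is exempt, it has a second vertex and hence slack. The claim is stated for
      arbitrary \<open>c\<close>, \<open>P\<close>, \<open>Q\<close> so that it also serves the
      reversed instance.\<close>
    have root_case: "orientable k W E g c"
      if v: "rooted k W E g c P Q" and zx: "2 * k dvd c x - P x + Q x" and wd: "cut_condition k W E g c P Q ?X"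
        and wx: "P x \<le> ?w E g" and PQ: "P x > 0" "Q x = 0"
        and slack: "\<And>A. A \<subseteq> W \<Longrightarrow> A \<noteq> W \<Longrightarrow> A \<notin> ?X \<Longrightarrow> 2 \<le> card A \<Longrightarrow> 4 * k - 2 + mod_norm k (demand c P Q A) \<le> rcut E g P Q A"
        and small: "\<And>(E' :: 'e set) g' c' P' Q'. card E' + nat (sum P' W + sum Q' W) < card E + nat (sum P W + sum Q W) \<Longrightarrow>
            rooted k W E' g' c' P' Q' \<Longrightarrow> 2 * k dvd c' x - P' x + Q' x \<Longrightarrow> cut_condition k W E' g' c' P' Q' ?X \<Longrightarrow>
            \<bar>P' x - Q' x\<bar> \<le> ?w E' g' \<Longrightarrow> orientable k W E' g' c'"
      for c P Q
    proof -
      have "?w E g \<noteq> 0" using wx PQ by linarith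
      have "\<exists>e\<in>E. flux (g e) {x} \<noteq> 0"
      proof (rule ccontr)
        assume "\<not> ?thesis"
        then have "?w E g = 0" by (intro sum.neutral) auto
        then show False using \<open>?w E g \<noteq> 0\<close> by simp
      qed
      then obtain e where e: "e \<in> E" "flux (g e) {x} \<noteq> 0" by blast
      obtain y where y: "joins (g e) x y" "y \<noteq> x" "y \<in> W" using obtain_joins[OF v e] by metis
      let ?c = "c(x := c x - 1, y := c y + 1)" and ?P = "P(x := P x - 1, y := P y + 1)"
      note r = root_lift[OF v e(1) y(1) y(2)[symmetric] PQ(1)]
      have "orientable k W (E - {e}) g ?c"
      proof (rule small[OF _ r(1)])
        show "card (E - {e}) + nat (sum ?P W + sum Q W) < card E + nat (sum P W + sum Q W)"
          using r(4) e fin card_gt_0_iff[of E] by (auto simp del: fun_upd_apply)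
        show "cut_condition k W (E - {e}) g ?c ?P Q ?X"
          unfolding cut_condition_def
        proof (intro allI impI)
          fix A assume A: "A \<subseteq> W" "A \<noteq> {}" "A \<noteq> W" "A \<notin> ?X"
          have "2 \<le> card A" if "x \<in> A" using A that two[OF A(1) that] by blast
          then show "4 * k - 4 + mod_norm k (demand ?c ?P Q A) \<le> rcut (E - {e}) g ?P Q A"
            unfolding r(2)[OF A(1)] r(3)[OF A(1)]
            using slack[OF A(1,3,4)] cut_conditionD[OF wd A] by (cases "x \<in> A") auto
        qed
        have "?w (E - {e}) g = ?w E g - 1"
          using cut_delete[where g = g and e = e, OF fin(2) e(1) y(1), of "{x}"] y by simp
        then show "\<bar>?P x - Q x\<bar> \<le> ?w (E - {e}) g" using wx PQ y(2) by simp
      qed (use zx y PQ in auto)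
      then show ?thesis using orientable_delete[where g = g and e = e, OF fin(2) e(1) y(1) y(2)[symmetric]] by blast
    qed
    have pos: "P x \<ge> 0" "Q x \<ge> 0" "sum P W \<ge> 0" "sum Q W \<ge> 0" using v x by (auto simp: rooted_def intro!: sum_nonneg)
    consider "P x > 0" "Q x > 0" | "P x > 0" "Q x = 0" | "P x = 0" "Q x > 0" | "P x = 0" "Q x = 0" 
      using pos by linarith
    then show ?thesis
    proof cases
      case 1
      \<comment> \<open>An arc from the root to \<open>x\<close> and one back cancel without
        changing the demand.\<close>
      let ?P = "P(x := P x + (-1))" and ?Q = "Q(x := Q x + (-1))"
      have sP: "sum ?P A = sum P A - of_bool (x \<in> A)" "sum ?Q A = sum Q A - of_bool (x \<in> A)" if "A \<subseteq> W" for A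
        using sum_upd1[of A P x "-1"] sum_upd1[of A Q x "-1"] finite_subset[OF that fin(1)] by simp_all
      have sW: "sum ?P W = sum P W - 1" "sum ?Q W = sum Q W - 1" using sP[of W] x by simp_all
      show ?thesis
      proof (rule hyp[of W E ?P ?Q g c x])
        have "P x \<le> sum P W" "Q x \<le> sum Q W" using v x fin by (auto simp: rooted_def intro!: member_le_sum)
        then show "card W < card W \<or> card W = card W \<and> card E + nat (sum ?P W + sum ?Q W) < card E + nat (sum P W + sum Q W)"
          using sW 1 by linarith
        have "root_bounded k (sum ?P W) (sum ?Q W)"
          using v unfolding sW by (auto simp: rooted_def root_bounded_def)
        moreover have "0 \<le> ?P u \<and> 0 \<le> ?Q u" if "u \<in> W" for u using v 1 that by (auto simp: rooted_def)
        ultimately show "rooted k W E g c ?P ?Q" using v by (simp add: rooted_def del: fun_upd_apply)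
        show "cut_condition k W E g c ?P ?Q ?X"
          unfolding cut_condition_def
        proof (intro allI impI)
          fix A assume A: "A \<subseteq> W" "A \<noteq> {}" "A \<noteq> W" "A \<notin> ?X"
          have "2 \<le> card A" if "x \<in> A" using A that two[OF A(1) that] by blast
          moreover have "demand c ?P ?Q A = demand c P Q A" using sP[OF A(1)] by (simp add: demand_sum del: fun_upd_apply)
          moreover have "rcut E g ?P ?Q A = rcut E g P Q A - 2 * of_bool (x \<in> A)"
            using sP[OF A(1)] by (simp add: rcut_def sum.distrib del: fun_upd_apply)
          ultimately show "4 * k - 4 + mod_norm k (demand c ?P ?Q A) \<le> rcut E g ?P ?Q A"
            using slack[OF A(1,3,4)] cut_conditionD[OF wd A] by (cases "x \<in> A") auto
        qed
      qed (use x W2 zx wx in \<open>auto simp: algebra_simps\<close>)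
    next
      case 2
      then have "P x \<le> ?w E g" using wx by simp
      then show ?thesis
        by (intro root_case[OF v zx wd _ 2 slack]) (auto intro!: hyp[OF _ _ x W2])
    next
      case 3
      have "orientable k W E g (\<lambda>v. - c v)"
      proof (rule root_case[OF rooted_uminus[OF k0 v] _ cut_condition_uminus[OF k0 wd]])
        have "- c x - Q x + P x = - (c x - P x + Q x)" by simp
        then show "2 * k dvd - c x - Q x + P x" using zx by (simp only: dvd_minus_iff)
        show "Q x \<le> ?w E g" using wx 3 by simp
        show "4 * k - 2 + mod_norm k (demand (\<lambda>v. - c v) Q P A) \<le> rcut E g Q P A"
          if "A \<subseteq> W" "A \<noteq> W" "A \<notin> ?X" "2 \<le> card A" for A
          using slack[OF that] by (simp add: demand_uminus rcut_swap mod_norm_uminus[OF k0])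
      qed (use 3 in \<open>auto intro!: hyp[OF _ _ x W2] simp: add.commute\<close>)
      then show ?thesis by (rule orientable_uminus)
    next
      case 4
      then have cx: "2 * k dvd c x" using zx by simp
      show ?thesis
      proof (cases "\<forall>e\<in>E. flux (g e) {x} = 0")
        case True
        note iso = drop_isolated[OF k0 v x 4 cx True]
        have "card (W - {x}) < card W" by (rule card_Diff1_less[OF fin(1) x])
        moreover have "W - {x} \<noteq> {}"
        proof
          assume "W - {x} = {}"
          then have "W \<subseteq> {x}" by blast
          then have "card W \<le> card {x}" by (intro card_mono) auto
          then show False using W2 by simp
        qed
        moreover have "cut_condition k (W - {x}) (inside E g (W - {x})) g c P Q {}"
          unfolding cut_condition_def
        proof (intro allI impI)
          fix B assume B: "B \<subseteq> W - {x}" "B \<noteq> {}" "B \<noteq> W - {x}"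
          then have "B \<subseteq> W" "B \<noteq> W" "B \<notin> ?X" "x \<notin> B" using x by auto
          then show "4 * k - 4 + mod_norm k (demand c P Q B) \<le> rcut (inside E g (W - {x})) g P Q B"
            using cut_conditionD[OF wd _ B(2)] iso(2) by simp
        qed
        ultimately show ?thesis using IH[OF iso(1)] iso(3) n by simp
      next
        case False
        then obtain e1 where e1: "e1 \<in> E" "flux (g e1) {x} \<noteq> 0" by blast
        obtain y1 where y1: "joins (g e1) x y1" "y1 \<noteq> x" "y1 \<in> W" using obtain_joins[OF v e1] by metis
        \<comment> \<open>Evenness provides a second edge at \<open>x\<close> to pair with
          \<open>e1\<close>.\<close>
        have ev: "even (?w E g)"
        proof -
          have "even (rcut E g P Q {x} - mod_norm k (demand c P Q {x}))" using rooted_parity[OF k0 v] x by simp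
          moreover have "mod_norm k (demand c P Q {x}) = 0" using mod_norm_0[OF k0 zx] by (simp add: demand_def)
          ultimately show ?thesis using 4 by (simp add: rcut_def)
        qed
        have ne1: "\<exists>e2\<in>E - {e1}. flux (g e2) {x} \<noteq> 0"
        proof (rule ccontr)
          assume "\<not> ?thesis"
          then have "?w (E - {e1}) g = 0" by (intro sum.neutral) auto
          then have "?w E g = 1" using cut_delete[where g = g and e = e1, OF fin(2) e1(1) y1(1), of "{x}"] y1 by simp
          then show False using ev by simp
        qed
        \<comment> \<open>The second edge gets an end other than \<open>y1\<close> whenever
          possible; a loop may arise only if all edges at \<open>x\<close> lead to
          \<open>y1\<close>.\<close>
        define single where "single \<longleftrightarrow> (\<forall>e\<in>E. flux (g e) {x} \<noteq> 0 \<longrightarrow> joins (g e) x y1)"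
        obtain e2 y2 where e2: "e2 \<in> E" "e1 \<noteq> e2" and y2: "joins (g e2) x y2" "y2 \<noteq> x" "y2 \<in> W"
          and y12: "y2 = y1 \<Longrightarrow> single"
        proof (cases single)
          case True
          obtain e2 where e2: "e2 \<in> E - {e1}" "flux (g e2) {x} \<noteq> 0" using ne1 by blast
          then obtain y2 where "joins (g e2) x y2" "y2 \<noteq> x" "y2 \<in> W" using obtain_joins[OF v _ e2(2)] by blast
          then show ?thesis using that[of e2 y2] e2 True by blast
        next
          case False
          then obtain e2 where e2: "e2 \<in> E" "flux (g e2) {x} \<noteq> 0" "\<not> joins (g e2) x y1" by (auto simp: single_def)
          then obtain y2 where "joins (g e2) x y2" "y2 \<noteq> x" "y2 \<in> W" using obtain_joins[OF v e2(1,2)] by metis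
          then show ?thesis using that[of e2 y2] e2 y1 by blast
        qed
        note pl = pair_lift[OF v e1(1) e2 y1(1) y2(1)]
        let ?g = "g(e1 := (y1, y2))"
        have "orientable k W (E - {e2}) ?g c"
        proof (rule hyp[OF _ pl(1) x W2 zx])
          show "card W < card W \<or> card W = card W \<and>
            card (E - {e2}) + nat (sum P W + sum Q W) < card E + nat (sum P W + sum Q W)"
            using card_Diff1_less[OF fin(2) e2(1)] by (intro disjI2 conjI refl) linarith
          show "\<bar>P x - Q x\<bar> \<le> ?w (E - {e2}) ?g" using 4 by (simp add: sum_nonneg)
          show "cut_condition k W (E - {e2}) ?g c P Q ?X"
            unfolding cut_condition_def
          proof (intro allI impI)
            fix A assume A: "A \<subseteq> W" "A \<noteq> {}" "A \<noteq> W" "A \<notin> ?X"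
            show "4 * k - 4 + mod_norm k (demand c P Q A) \<le> rcut (E - {e2}) ?g P Q A"
            proof (cases "(x \<in> A) \<noteq> (y1 \<in> A) \<and> (x \<in> A) \<noteq> (y2 \<in> A)")
              case lose: True
              show ?thesis
              proof (cases "2 \<le> card A")
                case True
                then show ?thesis unfolding pl(2) using lose slack[OF A(1,3,4)] by simp
              next
                case False
                then have xA: "x \<notin> A" using A two[OF A(1), of x] by blast
                then have yA: "y1 \<in> A" "y2 \<in> A" using lose by auto
                then have "y1 = y2" using False two[OF A(1)] by blast
                then have single using y12 by blast
                have fA: "finite A" using A fin finite_subset by blast
                \<comment> \<open>The critical case: \<open>A\<close> is the singleton of
                  \<open>y1\<close> and loses 2 without slack. Adding \<open>x\<close> to it keeps
                  the demand modulo \<open>2 * k\<close> and removes from the cut all edges at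
                  \<open>x\<close>, which number at least 2.\<close>
                let ?B = "insert x A"
                have B: "?B \<subseteq> W" "?B \<noteq> {}" "?B \<noteq> W" "?B \<notin> ?X" using A x xA by auto
                have "\<bar>flux (g e) A\<bar> = \<bar>flux (g e) ?B\<bar> + \<bar>flux (g e) {x}\<bar>" if "e \<in> E" for e
                proof (cases "flux (g e) {x} = 0")
                  case True
                  then show ?thesis using xA by (auto simp: flux_def split: if_splits)
                next
                  case False
                  then have "joins (g e) x y1" using \<open>single\<close> that by (simp add: single_def)
                  then show ?thesis using abs_flux_joins xA yA y1 by fastforce
                qed
                then have "(\<Sum>e\<in>E. \<bar>flux (g e) A\<bar>) = (\<Sum>e\<in>E. \<bar>flux (g e) ?B\<bar>) + ?w E g"
                  by (simp add: sum.distrib[symmetric])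
                then have dA: "rcut E g P Q A = rcut E g P Q ?B + ?w E g"
                  using 4 xA fA by (simp add: rcut_def)
                have "?w E g > 0" using e1 fin by (intro sum_pos2[of E e1]) auto
                then have "?w E g \<ge> 2" using ev by presburger
                then show ?thesis unfolding pl(2) using dA cut_conditionD[OF wd B] ndW[OF A(1) xA] by simp
              qed
            next
              case False
              then show ?thesis unfolding pl(2) using cut_conditionD[OF wd A] by auto
            qed
          qed
        qed
        then show ?thesis by (rule pl(3))
      qed
    qed
  qed
qed

section \<open>Orientations with prescribed net outdegrees\<close>

lemma flux_ends: "fst d \<in> W \<Longrightarrow> snd d \<in> W \<Longrightarrow> flux d W = 0"
  by (simp add: flux_def)

text \<open>If the excess \<open>\<bar>P x - Q x\<bar>\<close> of root edges at \<open>x\<close> is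
  at most the number of other edges there, \<open>zero_split\<close> applies; otherwise
  \<open>merge\<close> or its mirror image does.\<close>

lemma zero_step:
  fixes W :: "'v set" and E :: "'e set"
  assumes k: "k \<ge> 3"
    and IH: "\<And>(W :: 'v set) (E :: 'e set) g c P Q. rooted k W E g c P Q \<Longrightarrow> cut_condition k W E g c P Q {} \<Longrightarrow>
        W \<noteq> {} \<Longrightarrow> card W < n \<Longrightarrow> orientable k W E g c"
    and v: "rooted k W E g c P Q" and x: "x \<in> W" and n: "card W \<le> n" and W2: "2 \<le> card W"
    and zx: "2 * k dvd c x - P x + Q x"
    and wd: "cut_condition k W E g c P Q {}"
  shows "orientable k W E g c"
proof -
  have k0: "k > 0" using k by simp
  have fin: "finite W" "finite E" using v by (auto simp: rooted_def)
  define w where "w = (\<Sum>e\<in>E. \<bar>flux (g e) {x}\<bar>)"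
  have xW: "{x} \<noteq> W" using W2 by auto
  have Wx: "W - {x} \<noteq> {}" using xW x by blast
  have cW: "card (W - {x}) < n" using card_Diff1_less[OF fin(1) x] n by simp
  \<comment> \<open>Too many root edges at \<open>x\<close> to pair them off: \<open>x\<close> moves into the root, and the other edges at \<open>x\<close> are
    oriented with net outdegree \<open>P x - Q x - 2 k\<close> instead of \<open>P x - Q x\<close>.\<close>
  have merge: "orientable k W E g c"
    if v: "rooted k W E g c P Q" and zx: "2 * k dvd c x - P x + Q x" and wd: "cut_condition k W E g c P Q {}"
      and big: "P x - Q x > w" for c P Q
  proof -
    let ?A = "W - {x}"
    define N where "N = {e\<in>E. flux (g e) {x} \<noteq> 0}"
    have sum1: "sum h W = h x + sum h ?A" for h :: "'v \<Rightarrow> int" using fin x by (simp add: sum.remove)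
    have balA: "flux (g e) ?A = - flux (g e) {x}" if "e \<in> E" for e
      using flux_compl[of "g e" W x] v x that by (auto simp: rooted_def)
    have "w = (\<Sum>e\<in>E. of_bool (e \<in> N))" unfolding w_def N_def
      by (rule sum.cong) (auto simp: flux_def)
    then have wN: "w = int (card N)" using fin by (simp add: N_def Int_def)
    have nd0: "mod_norm k (demand c P Q {x}) = 0" using mod_norm_0[OF k0 zx] by (simp add: demand_def)
    have "even (rcut E g P Q {x} - mod_norm k (demand c P Q {x}))" using rooted_parity[OF k0 v] x by simp
    moreover have degx: "rcut E g P Q {x} = w + P x + Q x" by (simp add: rcut_def w_def)
    ultimately have "even (P x - Q x - w)" unfolding nd0 by presburger
    then obtain \<delta> where \<delta>: "P x - Q x - w = 2 * \<delta>" by (elim dvdE)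
    have \<delta>1: "\<delta> \<ge> 1" using big \<delta> by simp
    define \<gamma> where "\<gamma> = \<delta> + Q x"
    have pos: "P x \<ge> 0" "Q x \<ge> 0" using v x by (auto simp: rooted_def)
    have le: "P x \<le> sum P W" "Q x \<le> sum Q W" using v x fin by (auto simp: rooted_def intro!: member_le_sum)
    have root: "root_bounded k (sum P W) (sum Q W)" using v by (simp add: rooted_def)
    have "4 * k - 4 \<le> rcut E g P Q {x}" using cut_conditionD[OF wd, of "{x}"] x xW nd0 by simp
    then have d1: "4 * k - 4 \<le> w + P x + Q x" unfolding degx .
    \<comment> \<open>The demand of the complement of \<open>x\<close> has the norm of the root's
      imbalance. Hence that norm cancels between the lower bound on the cut of \<open>?A\<close> and
      the upper bound on the degree of the root, leaving \<open>d2\<close>.\<close>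
    have "mod_norm k (demand c P Q ?A) = mod_norm k (- (sum P W - sum Q W))"
    proof (rule mod_norm_cong)
      have "demand c P Q ?A - - (sum P W - sum Q W) = sum c W - (c x - P x + Q x)"
        by (simp add: demand_sum sum1)
      then show "2 * k dvd demand c P Q ?A - - (sum P W - sum Q W)" using v zx by (simp add: rooted_def)
    qed
    moreover have "rcut E g P Q ?A = w + (sum P W - P x) + (sum Q W - Q x)"
      unfolding rcut_def w_def sum.distrib sum1 by (simp add: balA)
    moreover have "4 * k - 4 + mod_norm k (demand c P Q ?A) \<le> rcut E g P Q ?A"
      using x Wx by (intro cut_conditionD[OF wd]) auto
    moreover have "sum P W + sum Q W \<le> 6 * k - 6 + mod_norm k (sum P W - sum Q W)" using root by (simp add: root_bounded_def)
    ultimately have d2: "P x + Q x - w \<le> 2 * k - 2" using mod_norm_uminus[OF k0, of "sum P W - sum Q W"] by linarith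
    \<comment> \<open>\<open>T\<close> is the set of edges to be oriented out of \<open>x\<close>.
      The remaining \<open>k - \<delta>\<close> edges enter \<open>x\<close>, which gives net
      outdegree \<open>w - 2 * k + 2 * \<delta>\<close>, that is, \<open>P x - Q x - 2 * k\<close>.
      The bounds \<open>d1\<close> and \<open>d2\<close> make this size of \<open>T\<close>
      possible.\<close>
    have "0 \<le> w - k + \<delta>" using d1 d2 \<delta>1 by linarith
    moreover have "w - k + \<delta> \<le> w" using d2 \<delta> pos by linarith
    ultimately obtain T where T: "T \<subseteq> N" "int (card T) = w - k + \<delta>"
      using obtain_subset_with_card_n[of "nat (w - k + \<delta>)" N] wN by (metis nat_le_iff nat_0_le)
    have fN: "finite N" "N \<subseteq> E" using fin by (auto simp: N_def)
    define s where "s e = (if e \<in> N then flux (g e) {x} * (if e \<in> T then 1 else -1) else 1)" for e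
    have sb: "s e * flux (g e) {x} = of_bool (e \<in> T) - of_bool (e \<in> N - T)" if "e \<in> E" for e
      using that T(1) by (auto simp: s_def N_def flux_def)
    have sE: "\<forall>e\<in>E. s e = 1 \<or> s e = -1" by (auto simp: s_def N_def flux_def)
    have cO: "(\<Sum>e\<in>E. of_bool (e \<in> T)) = w - k + \<delta>"
    proof -
      have "{e \<in> E. e \<in> T} = T" using T fN by blast
      then show ?thesis using T(2) fin by (simp add: Int_def)
    qed
    have cI: "(\<Sum>e\<in>E. of_bool (e \<in> N - T)) = k - \<delta>"
    proof -
      have "{e \<in> E. e \<in> N - T} = N - T" using T fN by blast
      moreover have "int (card (N - T)) = w - (w - k + \<delta>)"
        using T fN wN card_mono[OF fN(1) T(1)] finite_subset[OF T(1) fN(1)] by (simp add: card_Diff_subset of_nat_diff)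
      ultimately show ?thesis using fin by (simp add: Int_def)
    qed
    have net: "(\<Sum>e\<in>E. s e * flux (g e) {x}) = P x - Q x - 2 * k"
    proof -
      have "(\<Sum>e\<in>E. s e * flux (g e) {x}) = (\<Sum>e\<in>E. of_bool (e \<in> T) - of_bool (e \<in> N - T))"
        by (rule sum.cong[OF refl sb])
      then show ?thesis unfolding sum_subtractf cO cI using \<delta> by linarith
    qed
    have netA: "(\<Sum>e\<in>E. s e * flux (g e) ?A) = - (\<Sum>e\<in>E. s e * flux (g e) {x})"
      by (simp add: balA sum_negf)
    have m1: "(\<Sum>e\<in>E. max 0 (- (s e * flux (g e) ?A))) = w - k + \<delta>"
      unfolding cO[symmetric] by (rule sum.cong) (use T(1) in \<open>auto simp: balA sb\<close>)
    have m2: "(\<Sum>e\<in>E. max 0 (s e * flux (g e) ?A)) = k - \<delta>"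
      unfolding cI[symmetric] by (rule sum.cong) (use T(1) in \<open>auto simp: balA sb\<close>)
    have "\<exists>s'. (\<forall>e\<in>E. s' e = 1 \<or> s' e = (-1::int)) \<and> (\<forall>e\<in>E - inside E g ?A. s' e = s e) \<and>
      (\<forall>v\<in>?A. 2 * k dvd (\<Sum>e\<in>E. s' e * flux (g e) {v}) - c v)"
    proof (rule restrict[OF k0 v _ sE])
      have "(\<Sum>e\<in>E. s e * flux (g e) ?A) - sum c ?A = (c x - P x + Q x) - sum c W + 2 * k"
        unfolding netA net sum1 by simp
      then show "2 * k dvd (\<Sum>e\<in>E. s e * flux (g e) ?A) - sum c ?A"
        using zx v by (simp add: rooted_def)
      define a b where "a = sum P W" and "b = sum Q W"
      \<comment> \<open>The root degree drops by \<open>2 * \<gamma>\<close> and the imbalance by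
        \<open>2 * k\<close>, which \<open>mod_norm\<close> does not notice. As
        \<open>a \<ge> 2 * k - 1\<close>, the disjunction in \<open>root_bounded\<close> leaves
        \<open>b \<le> 2 * k - 2\<close> or both degrees at most \<open>3 * k - 1\<close>; either
        way the new indegree stays at most \<open>4 * k - 2\<close>.\<close>
      have p: "sum P ?A + (w - k + \<delta>) = a - \<gamma> - k" using \<delta> by (simp add: a_def sum1 \<gamma>_def)
      have q: "sum Q ?A + (k - \<delta>) = b + k - \<gamma>" by (simp add: b_def sum1 \<gamma>_def)
      have "mod_norm k ((a - \<gamma> - k) - (b + k - \<gamma>)) = mod_norm k (a - b)"
        by (rule mod_norm_cong) simp
      moreover have "a \<ge> 2 * k - 1" using le d1 \<delta> \<delta>1 by (simp add: a_def)
      moreover have "\<gamma> \<ge> 1" using \<delta>1 pos by (simp add: \<gamma>_def)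
      moreover have "root_bounded k a b" using root by (simp add: a_def b_def)
      ultimately have "root_bounded k (a - \<gamma> - k) (b + k - \<gamma>)"
        unfolding root_bounded_def min_le_iff_disj max.bounded_iff by auto
      then show "root_bounded k (sum P ?A + (\<Sum>e\<in>E. max 0 (- (s e * flux (g e) ?A))))
         (sum Q ?A + (\<Sum>e\<in>E. max 0 (s e * flux (g e) ?A)))" unfolding m1 m2 p q .
      fix c' P' Q'
      assume v': "rooted k ?A (inside E g ?A) g c' P' Q'"
        and dm: "\<And>B. B \<subseteq> ?A \<Longrightarrow> demand c' P' Q' B = demand c P Q B"
        and dg: "\<And>B. B \<subseteq> ?A \<Longrightarrow> rcut (inside E g ?A) g P' Q' B = rcut E g P Q B"
      have "cut_condition k ?A (inside E g ?A) g c' P' Q' {}"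
        unfolding cut_condition_def
      proof (intro allI impI)
        fix B assume B: "B \<subseteq> ?A" "B \<noteq> {}" "B \<noteq> ?A"
        have "B \<subseteq> W" "B \<noteq> W" using B x by auto
        then show "4 * k - 4 + mod_norm k (demand c' P' Q' B) \<le> rcut (inside E g ?A) g P' Q' B"
          using cut_conditionD[OF wd _ B(2)] by (simp add: dm dg B)
      qed
      then show "orientable k ?A (inside E g ?A) g c'" using IH[OF v'] Wx cW by simp
    qed auto
    then obtain s' where s': "\<forall>e\<in>E. s' e = 1 \<or> s' e = (-1::int)" "\<forall>e\<in>E - inside E g ?A. s' e = s e"
      "\<forall>v\<in>?A. 2 * k dvd (\<Sum>e\<in>E. s' e * flux (g e) {v}) - c v" by blast
    have "s' e * flux (g e) {x} = s e * flux (g e) {x}" if "e \<in> E" for e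
    proof (cases "e \<in> inside E g ?A")
      case True
      then have "flux (g e) {x} = 0" by (auto simp: inside_def flux_def)
      then show ?thesis by simp
    qed (use s' that in auto)
    then have "(\<Sum>e\<in>E. s' e * flux (g e) {x}) = P x - Q x - 2 * k" unfolding net[symmetric] by (rule sum.cong[OF refl])
    then have "(\<Sum>e\<in>E. s' e * flux (g e) {x}) - c x = - (c x - P x + Q x) - 2 * k" by simp
    moreover have "2 * k dvd - (c x - P x + Q x) - 2 * k" using zx by (metis dvd_diff dvd_minus_iff dvd_refl)
    ultimately have "2 * k dvd (\<Sum>e\<in>E. s' e * flux (g e) {x}) - c x" by (simp only:)
    then have "\<forall>v\<in>W. 2 * k dvd (\<Sum>e\<in>E. s' e * flux (g e) {v}) - c v" using s'(3) by blast
    then show ?thesis using s'(1) unfolding orientable_def by blast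
  qed
  consider "\<bar>P x - Q x\<bar> \<le> w" | "P x - Q x > w" | "Q x - P x > w" by linarith
  then show ?thesis
  proof cases
    case 1
    have "cut_condition k W E g c P Q {{x}, W - {x}}" using wd by (simp add: cut_condition_def)
    then show ?thesis using zero_split[OF k IH v x n W2 zx] 1 by (simp add: w_def)
  next
    case 2
    then show ?thesis using merge[OF v zx wd] by blast
  next
    case 3
    have "- c x - Q x + P x = - (c x - P x + Q x)" by simp
    then have "2 * k dvd - c x - Q x + P x" using zx by (simp only: dvd_minus_iff)
    then have "orientable k W E g (\<lambda>v. - c v)"
      by (rule merge[OF rooted_uminus[OF k0 v] _ cut_condition_uminus[OF k0 wd] 3])
    then show ?thesis by (rule orientable_uminus)
  qed
qed

text \<open>One vertex gets demand 0 modulo \<open>2 * k\<close> by a change of its root edges, and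
  \<open>zero_step\<close> takes over. If the root has no edges, \<open>t x\<close> arcs from the
  root to any \<open>x\<close> do this; otherwise the demand of a neighbour of the root is pushed up
  to \<open>2 * k\<close>.\<close>

lemma positive_step:
  fixes W :: "'v set" and E :: "'e set"
  assumes k: "k \<ge> 3"
    and IH: "\<And>(W :: 'v set) (E :: 'e set) g c P Q. rooted k W E g c P Q \<Longrightarrow> cut_condition k W E g c P Q {} \<Longrightarrow>
        W \<noteq> {} \<Longrightarrow> card W < n \<Longrightarrow> orientable k W E g c"
    and v: "rooted k W E g c P Q" and n: "card W \<le> n" and W2: "2 \<le> card W"
    and wd: "cut_condition k W E g c P Q {}"
    and slack: "\<And>A. A \<subseteq> W \<Longrightarrow> A \<noteq> W \<Longrightarrow> 2 \<le> card A \<Longrightarrow> 4 * k - 2 + mod_norm k (demand c P Q A) \<le> rcut E g P Q A"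
    and Q0: "\<And>x. x \<in> W \<Longrightarrow> Q x = 0"
    and pos: "\<And>x. x \<in> W \<Longrightarrow> 0 < (c x - P x + Q x) mod (2 * k) \<and> (c x - P x + Q x) mod (2 * k) < k"
  shows "orientable k W E g c"
proof -
  have k0: "k > 0" using k by simp
  have fin: "finite W" "finite E" using v by (auto simp: rooted_def)
  have root: "root_bounded k (sum P W) (sum Q W)" using v by (simp add: rooted_def)
  have P0: "P x \<ge> 0" if "x \<in> W" for x using v that by (auto simp: rooted_def)
  define t where "t x = (c x - P x + Q x) mod (2 * k)" for x
  have t: "0 < t x" "t x < k" "mod_norm k (c x - P x + Q x) = t x" "2 * k dvd c x - P x + Q x - t x" if "x \<in> W" for x
    using pos[OF that] by (auto simp: t_def mod_norm_def minus_mod_eq_mult_div)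
  \<comment> \<open>\<open>p\<close> and \<open>q\<close> are the changes in the numbers of arcs
    from the root to \<open>x\<close> and back. For \<open>p \<ge> 0\<close> the cut grows by as
    much as the norm can; for \<open>p < 0\<close> it may fall 2 short, which the slack of larger
    sets pays, while \<open>{x}\<close> profits from its demand becoming 0.\<close>
  have adjust: "orientable k W E g c"
    if x: "x \<in> W" and pq: "P x + p \<ge> 0" "q \<ge> 0" "p + q \<ge> \<bar>q - p\<bar> - 2" "p \<ge> 0 \<Longrightarrow> q = 0" "p + q + t x \<ge> 0"
      and z: "2 * k dvd t x - p + q" and r: "root_bounded k (sum P W + p) q" for x p q
  proof -
    let ?P = "P(x := P x + p)" and ?Q = "Q(x := Q x + q)"
    have s: "sum ?P A = sum P A + p * of_bool (x \<in> A)" "sum ?Q A = sum Q A + q * of_bool (x \<in> A)" if "A \<subseteq> W" for A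
      using sum_upd1[of A] finite_subset[OF that fin(1)] by blast+
    have Q0W: "sum Q W = 0" using Q0 by (simp add: sum.neutral)
    have z': "2 * k dvd c x - ?P x + ?Q x"
    proof -
      have "2 * k dvd (c x - P x + Q x - t x) + (t x - p + q)" using t(4)[OF x] z by (rule dvd_add)
      then show ?thesis by (simp add: algebra_simps)
    qed
    show ?thesis
    proof (rule zero_step[where P = ?P and Q = ?Q and c = c and x = x, OF k IH _ x n W2 z'])
      have "root_bounded k (sum ?P W) (sum ?Q W)" using r s[of W] x Q0W by simp
      moreover have "0 \<le> ?P u \<and> 0 \<le> ?Q u" if "u \<in> W" for u using P0 Q0 pq x that by auto
      ultimately show "rooted k W E g c ?P ?Q" using v by (simp add: rooted_def del: fun_upd_apply)
      show "cut_condition k W E g c ?P ?Q {}"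
        unfolding cut_condition_def
      proof (intro allI impI)
        fix A assume A: "A \<subseteq> W" "A \<noteq> {}" "A \<noteq> W" "A \<notin> {}"
        have dm: "demand c ?P ?Q A = demand c P Q A + (q - p) * of_bool (x \<in> A)"
          using s[OF A(1)] by (simp add: demand_sum algebra_simps del: fun_upd_apply)
        have dg: "rcut E g ?P ?Q A = rcut E g P Q A + (p + q) * of_bool (x \<in> A)"
          using s[OF A(1)] by (simp add: rcut_def sum.distrib algebra_simps del: fun_upd_apply)
        show "4 * k - 4 + mod_norm k (demand c ?P ?Q A) \<le> rcut E g ?P ?Q A"
        proof (cases "x \<in> A")
          case False
          then show ?thesis using dm dg cut_conditionD[OF wd A] by simp
        next
          case True
          show ?thesis
          proof (cases "p \<ge> 0")
            case p0: True
            then have "mod_norm k (demand c P Q A + (q - p)) \<le> mod_norm k (demand c P Q A) + p"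
              using mod_norm_lipschitz[OF k0, of "demand c P Q A" "q - p"] pq by simp
            then show ?thesis using dm dg cut_conditionD[OF wd A] True pq(4)[OF p0] by simp
          next
            case p0: False
            show ?thesis
            proof (cases "A = {x}")
              case Ax: True
              have "demand c P Q {x} = c x - P x + Q x" by (simp add: demand_def)
              then have "mod_norm k (demand c P Q A) = t x" using t(3)[OF x] Ax by simp
              then have "4 * k - 4 + t x \<le> rcut E g P Q A" using cut_conditionD[OF wd A] by simp
              moreover have "mod_norm k (demand c ?P ?Q A) = 0" using mod_norm_0[OF k0 z'] Ax by (simp add: demand_def)
              ultimately show ?thesis unfolding dg using True pq(5) by simp
            next
              case Ax: False
              then obtain y where y: "y \<in> A" "y \<noteq> x" using True by blast
              then have "card {x, y} \<le> card A" using True finite_subset[OF A(1) fin(1)] by (intro card_mono) auto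
              then have "4 * k - 2 + mod_norm k (demand c P Q A) \<le> rcut E g P Q A" using y by (intro slack A) simp
              then show ?thesis unfolding dm dg
                using True mod_norm_lipschitz[OF k0, of "demand c P Q A" "q - p"] pq(3) by simp
            qed
          qed
        qed
      qed
    qed
  qed
  show ?thesis
  proof (cases "sum P W = 0")
    case True
    obtain x where x: "x \<in> W" using W2 by fastforce
    show ?thesis
    proof (rule adjust[OF x, of "t x" 0])
      show "root_bounded k (sum P W + t x) 0"
        using True t[OF x] k mod_norm_bounds[OF k0, of "t x"] by (simp add: root_bounded_def)
    qed (use t[OF x] P0[OF x] in auto)
  next
    case False
    then obtain x where x: "x \<in> W" "P x \<noteq> 0" by (meson sum.neutral)
    then have Px: "P x > 0" using P0[OF x(1)] by simp
    have t1: "1 \<le> t x" "t x \<le> k - 1" using t[OF x(1)] by auto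
    \<comment> \<open>The demand of \<open>x\<close> is raised to \<open>2 k\<close>: one edge from the root to \<open>x\<close> is deleted, and \<open>2 k - t x - 1\<close>
      edges from \<open>x\<close> to the root are added.\<close>
    let ?q = "2 * k - t x - 1"
    show ?thesis
    proof (rule adjust[OF x(1), of "-1" ?q])
      define o' where "o' = sum P W"
      have o4: "o' \<le> 4 * k - 2" using root by (simp add: root_bounded_def o'_def)
      have "o' - 1 + ?q \<le> 6 * k - 6 + mod_norm k (o' - 1 - ?q)"
      \<comment> \<open>The degree sum exceeds \<open>6 * k - 6\<close> only in this extreme case,
        and by 1; there the imbalance is \<open>2 * k - 1\<close>, of norm 1.\<close>
      proof (cases "o' = 4 * k - 2 \<and> t x = 1")
        case True
        have "mod_norm k (o' - 1 - ?q) = mod_norm k (- 1)"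
          by (rule mod_norm_cong) (use True in simp)
        also have "\<dots> = 1" using mod_norm_self[of 1 k] mod_norm_uminus[OF k0, of 1] k by simp
        finally show ?thesis using True by simp
      next
        case False
        then have "o' - t x \<le> 4 * k - 4" using o4 t1 by linarith
        then show ?thesis using mod_norm_bounds(1)[OF k0, of "o' - 1 - ?q"] by linarith
      qed
      then show "root_bounded k (sum P W + - 1) ?q"
        using o4 t1 k by (simp add: root_bounded_def o'_def min_le_iff_disj)
    qed (use t1 Px in auto)
  qed
qed

text \<open>The outer induction on vertices enters as hypothesis; the inner one is on edges. Without
  tight sets and zero demands, edges are deleted as long as the singletons permit, and the instance
  left over is shown to have demands of one sign.\<close>

lemma orientation_step:
  fixes W :: "'v set" and E :: "'e set"
  assumes k: "k \<ge> 3"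
    and IH: "\<And>(W :: 'v set) (E :: 'e set) g c P Q. rooted k W E g c P Q \<Longrightarrow> cut_condition k W E g c P Q {} \<Longrightarrow>
        W \<noteq> {} \<Longrightarrow> card W < card V \<Longrightarrow> orientable k W E g c"
    and V2: "2 \<le> card (V :: 'v set)"
    and "rooted k V E g c P Q" "cut_condition k V E g c P Q {}"
  shows "orientable k V E g c"
  using assms(4,5)
proof (induction "card E + nat (sum P V + sum Q V)" arbitrary: E g c P Q rule: less_induct)
  case (less E P Q g c)
  note v = less(2) and wd = less(3)
  have k0: "k > 0" using k by simp
  have fin: "finite V" "finite E" using v by (auto simp: rooted_def)
  show ?case
  proof (cases "\<exists>A. A \<subseteq> V \<and> A \<noteq> V \<and> 2 \<le> card A \<and> rcut E g P Q A = 4 * k - 4 + mod_norm k (demand c P Q A)")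
    case True
    then obtain A where A: "A \<subseteq> V" "A \<noteq> V" "2 \<le> card A"
      and tight: "rcut E g P Q A = 4 * k - 4 + mod_norm k (demand c P Q A)" by blast
    have fA: "finite A" using A fin finite_subset by blast
    have cA: "card A < card V" using A fin by (simp add: psubset_card_mono psubset_eq)
    have "A \<noteq> {}" using A by auto
    then obtain a where a: "a \<in> A" by blast
    let ?W = "insert a (V - A)"
    have "card ?W = card V - card A + 1" using fin fA A a by (simp add: card_Diff_subset)
    then have cW: "card ?W < card V" using A(3) cA by linarith
    show ?thesis
    proof (rule tight_reduce[OF k v A(1) a tight])
      show "orientable k ?W E (map_prod (collapse A a) (collapse A a) \<circ> g) (c(a := sum c A))"
      proof (rule IH[OF contract_rooted[OF v A(1) a]])
        show "cut_condition k ?W E (map_prod (collapse A a) (collapse A a) \<circ> g) (c(a := sum c A)) (P(a := sum P A)) (Q(a := sum Q A)) {}"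
          unfolding cut_condition_def
        proof (intro allI impI)
          fix B assume B: "B \<subseteq> ?W" "B \<noteq> {}" "B \<noteq> ?W"
          show "4 * k - 4 + mod_norm k (demand (c(a := sum c A)) (P(a := sum P A)) (Q(a := sum Q A)) B)
              \<le> rcut E (map_prod (collapse A a) (collapse A a) \<circ> g) (P(a := sum P A)) (Q(a := sum Q A)) B"
            unfolding contract_rcut[OF fin(1) A(1) a B(1)] contract_demand[OF fin(1) A(1) a B(1)]
            using uncollapse_proper[OF A(1) a B] by (intro cut_conditionD[OF wd]) auto
        qed
      qed (use cW in auto)
    next
      fix c' P' Q'
      assume v': "rooted k A (inside E g A) g c' P' Q'"
        and dm: "\<And>B. B \<subseteq> A \<Longrightarrow> demand c' P' Q' B = demand c P Q B"
        and dg: "\<And>B. B \<subseteq> A \<Longrightarrow> rcut (inside E g A) g P' Q' B = rcut E g P Q B"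
      have "cut_condition k A (inside E g A) g c' P' Q' {}"
        unfolding cut_condition_def
      proof (intro allI impI)
        fix B assume B: "B \<subseteq> A" "B \<noteq> {}" "B \<noteq> A"
        have "B \<subseteq> V" "B \<noteq> V" using A B by auto
        then show "4 * k - 4 + mod_norm k (demand c' P' Q' B) \<le> rcut (inside E g A) g P' Q' B"
          using cut_conditionD[OF wd _ B(2)] by (simp add: dm dg B)
      qed
      then show "orientable k A (inside E g A) g c'" using IH[OF v'] a cA by blast
    qed
  next
    case False
    have slack: "4 * k - 2 + mod_norm k (demand c P Q A) \<le> rcut E g P Q A"
      if "A \<subseteq> V" "A \<noteq> V" "2 \<le> card A" for A
    proof -
      have "A \<noteq> {}" using that(3) by auto
      moreover have "rcut E g P Q A \<noteq> 4 * k - 4 + mod_norm k (demand c P Q A)" using False that by blast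
      ultimately show ?thesis using slack2[OF k0 v wd that(1) _ that(2)] by blast
    qed
    show ?thesis
    proof (cases "\<exists>x\<in>V. 2 * k dvd c x - P x + Q x")
      case True
      then obtain x where x: "x \<in> V" "2 * k dvd c x - P x + Q x" by blast
      show ?thesis by (rule zero_step[OF k IH v x(1) order_refl V2 x(2) wd])
    next
      case nonzero: False
      define \<tau> where "\<tau> x = c x - P x + Q x" for x
      define D where "D x = rcut E g P Q {x}" for x
      \<comment> \<open>\<open>outok x\<close> says that \<open>{x}\<close> survives the deletion of
        an edge oriented out of \<open>x\<close>, which lowers its demand and its cut by 1;
        \<open>inok x\<close> is the same for an edge oriented into \<open>x\<close>. By
        \<open>inok\<close> and \<open>outok\<close> below every vertex has at least one of these
        properties.\<close>
      define outok where "outok x \<longleftrightarrow> 4 * k - 4 + mod_norm k (\<tau> x - 1) \<le> D x - 1" for x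
      define inok where "inok x \<longleftrightarrow> 4 * k - 4 + mod_norm k (\<tau> x + 1) \<le> D x - 1" for x
      have sing: "{x} \<noteq> V" for x using V2 by auto
      have Dx: "4 * k - 4 + mod_norm k (\<tau> x) \<le> D x" if "x \<in> V" for x
        using cut_conditionD[OF wd, of "{x}"] that sing by (simp add: D_def \<tau>_def demand_def)
      have tpos: "0 < \<tau> x mod (2 * k)" if "x \<in> V" for x
        using nonzero that k0 by (simp add: \<tau>_def dvd_eq_mod_eq_0 order_less_le)
      have inok: "inok x" if "x \<in> V" "k \<le> \<tau> x mod (2 * k)" for x
        using mod_norm_succ[OF k0 that(2)] Dx[OF that(1)] by (simp add: inok_def)
      have outok: "outok x" if "x \<in> V" "\<tau> x mod (2 * k) \<le> k" for x
        using mod_norm_pred[OF k0 tpos that(2)] Dx[OF that(1)] that(1) by (simp add: outok_def)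
      have two: "A = {x} \<or> 2 \<le> card A" if "A \<subseteq> V" "x \<in> A" for A x
      proof (rule disjCI)
        assume "\<not> 2 \<le> card A"
        moreover have "card A \<noteq> 0" using that finite_subset[OF that(1) fin(1)] by auto
        ultimately have "card A = 1" by linarith
        then show "A = {x}" using that(2) by (auto simp: card_1_singleton_iff)
      qed
      \<comment> \<open>Deletes an arc from the root to \<open>x\<close>; arcs to the root are
        covered by reversal.\<close>
      have root_del: "orientable k V E g c"
        if v: "rooted k V E g c P Q" and wd: "cut_condition k V E g c P Q {}" and x: "x \<in> V" and Px: "P x > 0"
          and ok: "4 * k - 4 + mod_norm k (c x - P x + Q x + 1) \<le> rcut E g P Q {x} - 1"
          and slack: "\<And>A. A \<subseteq> V \<Longrightarrow> A \<noteq> V \<Longrightarrow> 2 \<le> card A \<Longrightarrow> 4 * k - 2 + mod_norm k (demand c P Q A) \<le> rcut E g P Q A"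
          and small: "\<And>P' Q'. card E + nat (sum P' V + sum Q' V) < card E + nat (sum P V + sum Q V) \<Longrightarrow>
            rooted k V E g c P' Q' \<Longrightarrow> cut_condition k V E g c P' Q' {} \<Longrightarrow> orientable k V E g c"
        for c P Q x
      proof -
        let ?P = "P(x := P x + (-1))"
        have s: "sum ?P A = sum P A - of_bool (x \<in> A)" if "A \<subseteq> V" for A
          using sum_upd1[of A P x "-1"] finite_subset[OF that fin(1)] by simp
        have sV: "sum ?P V = sum P V - 1" using s[of V] x by simp
        show ?thesis
        proof (rule small)
          have "P x \<le> sum P V" using v x fin by (auto simp: rooted_def intro!: member_le_sum)
          moreover have "0 \<le> sum Q V" using v by (auto simp: rooted_def intro!: sum_nonneg)
          ultimately show "card E + nat (sum ?P V + sum Q V) < card E + nat (sum P V + sum Q V)"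
            using sV Px by linarith
          have "mod_norm k (sum P V - sum Q V) \<le> mod_norm k (sum P V - 1 - sum Q V) + 1"
            using mod_norm_lipschitz[OF k0, of "sum P V - 1 - sum Q V" 1] by simp
          then have "root_bounded k (sum ?P V) (sum Q V)"
            using v unfolding sV rooted_def root_bounded_def by auto
          moreover have "0 \<le> ?P u \<and> 0 \<le> Q u" if "u \<in> V" for u using v Px that by (auto simp: rooted_def)
          ultimately show "rooted k V E g c ?P Q" using v by (simp add: rooted_def del: fun_upd_apply)
          show "cut_condition k V E g c ?P Q {}"
            unfolding cut_condition_def
          proof (intro allI impI)
            fix A assume A: "A \<subseteq> V" "A \<noteq> {}" "A \<noteq> V" "A \<notin> {}"
            have dm: "demand c ?P Q A = demand c P Q A + of_bool (x \<in> A)"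
              using s[OF A(1)] by (simp add: demand_sum del: fun_upd_apply)
            have dg: "rcut E g ?P Q A = rcut E g P Q A - of_bool (x \<in> A)"
              using s[OF A(1)] by (simp add: rcut_def sum.distrib del: fun_upd_apply)
            consider "x \<notin> A" | "A = {x}" | "x \<in> A" "2 \<le> card A" using two A(1) by blast
            then show "4 * k - 4 + mod_norm k (demand c ?P Q A) \<le> rcut E g ?P Q A"
            proof cases
              case 1
              then show ?thesis unfolding dm dg using cut_conditionD[OF wd A] by simp
            next
              case 2
              have "demand c P Q {x} = c x - P x + Q x" by (simp add: demand_def)
              then show ?thesis unfolding dm dg using ok 2 by simp
            next
              case 3
              then show ?thesis unfolding dm dg
                using slack[OF A(1,3) 3(2)] mod_norm_lipschitz[OF k0, of "demand c P Q A" 1] by simp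
            qed
          qed
        qed
      qed
      consider (P) x where "x \<in> V" "P x > 0" "inok x" | (Q) x where "x \<in> V" "Q x > 0" "outok x"
        | (E) e u w where "e \<in> E" "joins (g e) u w" "u \<noteq> w" "outok u" "inok w"
        | (final) "\<And>x. x \<in> V \<Longrightarrow> P x > 0 \<Longrightarrow> \<not> inok x" "\<And>x. x \<in> V \<Longrightarrow> Q x > 0 \<Longrightarrow> \<not> outok x"
          "\<And>e u w. e \<in> E \<Longrightarrow> joins (g e) u w \<Longrightarrow> u \<noteq> w \<Longrightarrow> outok u \<Longrightarrow> \<not> inok w" by blast
      then show ?thesis
      proof cases
        case P
        show ?thesis
        proof (rule root_del[OF v wd P(1,2)])
          show "4 * k - 4 + mod_norm k (c x - P x + Q x + 1) \<le> rcut E g P Q {x} - 1"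
            using P(3) by (simp add: inok_def D_def \<tau>_def)
          show "4 * k - 2 + mod_norm k (demand c P Q A) \<le> rcut E g P Q A"
            if "A \<subseteq> V" "A \<noteq> V" "2 \<le> card A" for A using slack[OF that] .
          show "orientable k V E g c"
            if "card E + nat (sum P' V + sum Q' V) < card E + nat (sum P V + sum Q V)"
              "rooted k V E g c P' Q'" "cut_condition k V E g c P' Q' {}" for P' Q'
            using less(1)[OF that] .
        qed
      next
        case Q
        have "orientable k V E g (\<lambda>v. - c v)"
        proof (rule root_del[OF rooted_uminus[OF k0 v] cut_condition_uminus[OF k0 wd] Q(1,2)])
          have "- c x - Q x + P x + 1 = - (\<tau> x - 1)" by (simp add: \<tau>_def)
          then show "4 * k - 4 + mod_norm k (- c x - Q x + P x + 1) \<le> rcut E g Q P {x} - 1"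
            using Q(3) by (simp only: mod_norm_uminus[OF k0]) (simp add: outok_def D_def rcut_swap)
          show "4 * k - 2 + mod_norm k (demand (\<lambda>v. - c v) Q P A) \<le> rcut E g Q P A"
            if "A \<subseteq> V" "A \<noteq> V" "2 \<le> card A" for A
            using slack[OF that] by (simp add: demand_uminus rcut_swap mod_norm_uminus[OF k0])
          show "orientable k V E g (\<lambda>v. - c v)"
            if "card E + nat (sum P' V + sum Q' V) < card E + nat (sum Q V + sum P V)"
              "rooted k V E g (\<lambda>v. - c v) P' Q'" "cut_condition k V E g (\<lambda>v. - c v) P' Q' {}" for P' Q'
            using less(1)[OF _ that(2,3)] that(1) by (simp add: add.commute)
        qed
        then show ?thesis by (rule orientable_uminus)
      next
        case (E e u w)
        have uw: "u \<in> V" "w \<in> V" using v E by (auto simp: rooted_def joins_def)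
        let ?c = "c(u := c u - 1, w := c w + 1)"
        have "rooted k V (E - {e}) g ?c P Q"
          using v by (intro rooted_delete[OF v E(1-3)]) (auto simp: rooted_def)
        moreover have "cut_condition k V (E - {e}) g ?c P Q {}"
          unfolding cut_condition_def
        proof (intro allI impI)
          fix A assume A: "A \<subseteq> V" "A \<noteq> {}" "A \<noteq> V" "A \<notin> {}"
          have fA: "finite A" using A fin finite_subset by blast
          have dm: "demand ?c P Q A = demand c P Q A - of_bool (u \<in> A) + of_bool (w \<in> A)"
            using sum_upd2[OF fA E(3), of c "-1" 1] by (simp add: demand_sum del: fun_upd_apply)
          have dg: "rcut (E - {e}) g P Q A = rcut E g P Q A - of_bool ((u \<in> A) \<noteq> (w \<in> A))"
            using cut_delete[where g = g and e = e, OF fin(2) E(1,2), of A] by (simp add: rcut_def)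
          have d1: "demand c P Q {x} = \<tau> x" for x by (simp add: demand_def \<tau>_def)
          consider "(u \<in> A) = (w \<in> A)" | "A = {u}" | "A = {w}" | "(u \<in> A) \<noteq> (w \<in> A)" "2 \<le> card A"
            using two A(1) by blast
          then show "4 * k - 4 + mod_norm k (demand ?c P Q A) \<le> rcut (E - {e}) g P Q A"
          proof cases
            case 1
            then show ?thesis unfolding dm dg using cut_conditionD[OF wd A] by simp
          next
            case 2
            then show ?thesis unfolding dm dg using E(3,4) by (simp add: d1 outok_def D_def)
          next
            case 3
            then show ?thesis unfolding dm dg using E(3,5) by (simp add: d1 inok_def D_def)
          next
            case 4
            then show ?thesis unfolding dm dg
              using slack[OF A(1,3) 4(2)] mod_norm_lipschitz[OF k0, of "demand c P Q A" 1]
                mod_norm_lipschitz[OF k0, of "demand c P Q A" "-1"] by auto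
          qed
        qed
        moreover have "card (E - {e}) < card E" using fin E by (intro card_Diff1_less)
        ultimately have "orientable k V (E - {e}) g ?c" by (intro less(1)) auto
        then show ?thesis using orientable_delete[where g = g and e = e, OF fin(2) E(1-3)] by blast
      next
        case final
        define N where "N = {x \<in> V. inok x}"
        \<comment> \<open>A vertex of both kinds could lose any edge, since the other end is of some
          kind. As nothing is deletable any more, it would have an empty cut, against the cut
          condition.\<close>
        have excl: "\<not> outok x" if x: "x \<in> N" for x
        proof
          assume "outok x"
          have xV: "x \<in> V" "inok x" using x by (auto simp: N_def)
          have PQ: "P x \<ge> 0" "Q x \<ge> 0" using v xV by (auto simp: rooted_def)
          have "flux (g e) {x} = 0" if e: "e \<in> E" for e
          proof (rule ccontr)
            assume "flux (g e) {x} \<noteq> 0"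
            then obtain y where y: "joins (g e) x y" "y \<noteq> x" "y \<in> V" using obtain_joins[OF v e] by metis
            then have y': "joins (g e) y x" by (auto simp: joins_def)
            have "outok y \<or> inok y" using inok[OF y(3)] outok[OF y(3)] by linarith
            then show False using final(3)[OF that y(1)] final(3)[OF that y'] y xV \<open>outok x\<close> by blast
          qed
          moreover have "P x = 0" "Q x = 0" using final(1,2)[OF xV(1)] PQ xV \<open>outok x\<close> by fastforce+
          ultimately have "D x = 0" by (simp add: D_def rcut_def)
          then show False using Dx[OF xV(1)] mod_norm_bounds(1)[OF k0, of "\<tau> x"] k by simp
        qed
        have NV: "N \<subseteq> V" by (auto simp: N_def)
        \<comment> \<open>No edge joins \<open>N\<close> to its complement, so the two cuts together
          consist of root edges. They need at least \<open>8 * k - 8\<close> plus the norm of the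
          imbalance, whereas the root offers only \<open>6 * k - 6\<close> plus that norm.\<close>
        have "N = {} \<or> N = V"
        proof (rule ccontr)
          assume "\<not> ?thesis"
          then have ne: "N \<noteq> {}" "N \<noteq> V" by auto
          let ?M = "V - N"
          have cross: "flux (g e) N = 0" if "e \<in> E" for e
          proof (rule ccontr)
            assume b: "flux (g e) N \<noteq> 0"
            obtain p q where pq: "g e = (p, q)" by fastforce
            have "p \<in> V" "q \<in> V" using v that pq by (auto simp: rooted_def)
            have either: "outok y" if "y \<in> V" "y \<notin> N" for y
              using that outok[of y] inok[of y] linear[of "\<tau> y mod (2 * k)" k] by (auto simp: N_def)
            have inN: "inok y" if "y \<in> N" for y using that by (simp add: N_def)
            have j: "joins (g e) p q" "joins (g e) q p" using pq by (auto simp: joins_def)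
            have ne: "p \<noteq> q" "(p \<in> N) \<noteq> (q \<in> N)" using b pq by (auto split: if_splits)
            show False
            proof (cases "p \<in> N")
              case True
              then show False using final(3)[OF that j(2)] ne either[OF \<open>q \<in> V\<close>] inN[of p] by blast
            next
              case False
              then show False using final(3)[OF that j(1)] ne either[OF \<open>p \<in> V\<close>] inN[of q] by blast
            qed
          qed
          have crossM: "flux (g e) ?M = 0" if "e \<in> E" for e
            using cross[OF that] v that by (auto simp: rooted_def flux_def split: if_splits)
          have sV: "sum h V = sum h N + sum h ?M" for h :: "'v \<Rightarrow> int"
            using fin NV sum.subset_diff[of N V h] by simp
          have "rcut E g P Q N + rcut E g P Q ?M = sum P V + sum Q V"
            using cross crossM by (simp add: rcut_def sV sum.distrib)
          moreover have "4 * k - 4 + mod_norm k (demand c P Q N) \<le> rcut E g P Q N"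
            using ne NV by (intro cut_conditionD[OF wd]) auto
          moreover have "4 * k - 4 + mod_norm k (demand c P Q ?M) \<le> rcut E g P Q ?M"
            using ne NV by (intro cut_conditionD[OF wd]) auto
          moreover have "mod_norm k (demand c P Q N + demand c P Q ?M) \<le> mod_norm k (demand c P Q N) + mod_norm k (demand c P Q ?M)"
            by (rule mod_norm_triangle[OF k0])
          moreover have "mod_norm k (demand c P Q N + demand c P Q ?M) = mod_norm k (- (sum P V - sum Q V))"
            by (rule mod_norm_cong) (use v in \<open>simp add: rooted_def demand_sum sV\<close>)
          moreover have "sum P V + sum Q V \<le> 6 * k - 6 + mod_norm k (sum P V - sum Q V)"
            using v by (simp add: rooted_def root_bounded_def)
          ultimately show False using mod_norm_uminus[OF k0, of "sum P V - sum Q V"] k by linarith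
        qed
        then show ?thesis
        proof
          assume "N = {}"
          then have ni: "\<not> inok x" if "x \<in> V" for x using that by (auto simp: N_def)
          have lt: "\<tau> x mod (2 * k) < k" if "x \<in> V" for x using ni[OF that] inok[OF that] by linarith
          show ?thesis
          proof (rule positive_step[OF k IH v order_refl V2 wd slack])
            show "Q x = 0" if "x \<in> V" for x
              using final(2)[OF that] outok[OF that] lt[OF that] v that by (fastforce simp: rooted_def)
            show "0 < (c x - P x + Q x) mod (2 * k) \<and> (c x - P x + Q x) mod (2 * k) < k" if "x \<in> V" for x
              using lt[OF that] tpos[OF that] by (simp add: \<tau>_def)
          qed auto
        next
          assume "N = V"
          then have no: "\<not> outok x" "inok x" if "x \<in> V" for x using excl[of x] that by (auto simp: N_def)
          have gt: "k < \<tau> x mod (2 * k)" if "x \<in> V" for x using no[OF that] outok[OF that] by linarith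
          have "orientable k V E g (\<lambda>v. - c v)"
          proof (rule positive_step[OF k IH rooted_uminus[OF k0 v] order_refl V2 cut_condition_uminus[OF k0 wd]])
            show "4 * k - 2 + mod_norm k (demand (\<lambda>v. - c v) Q P A) \<le> rcut E g Q P A"
              if "A \<subseteq> V" "A \<noteq> V" "2 \<le> card A" for A
              using slack[OF that] by (simp add: demand_uminus rcut_swap mod_norm_uminus[OF k0])
            show "P x = 0" if "x \<in> V" for x
              using final(1)[OF that] no[OF that] v that by (fastforce simp: rooted_def)
            show "0 < (- c x - Q x + P x) mod (2 * k) \<and> (- c x - Q x + P x) mod (2 * k) < k" if "x \<in> V" for x
            proof -
              have "- c x - Q x + P x = - \<tau> x" by (simp add: \<tau>_def)
              moreover have "(- \<tau> x) mod (2 * k) = 2 * k - \<tau> x mod (2 * k)"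
                using gt[OF that] k0 by (simp add: zmod_zminus1_eq_if)
              moreover have "\<tau> x mod (2 * k) < 2 * k" using k0 by simp
              ultimately show ?thesis using gt[OF that] by simp
            qed
          qed auto
          then show ?thesis by (rule orientable_uminus)
        qed
      qed
    qed
  qed
qed

lemma orientation:
  fixes W :: "'v set" and E :: "'e set"
  assumes k: "k \<ge> 3" and "rooted k W E g c P Q" "cut_condition k W E g c P Q {}" "W \<noteq> {}"
  shows "orientable k W E g c"
  using assms(2-)
proof (induction "card W" arbitrary: W E g c P Q rule: less_induct)
  case (less W E g c P Q)
  have fin: "finite W" using less by (simp add: rooted_def)
  show ?case
  proof (cases "2 \<le> card W")
    case True
    show ?thesis
      by (rule orientation_step[OF k _ True less(2,3)]) (use less(1) in blast)
  next
    case False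
    moreover have "card W \<noteq> 0" using fin less(4) by simp
    ultimately have "card W = 1" by linarith
    then obtain x where W: "W = {x}" by (auto simp: card_1_singleton_iff)
    have "flux (g e) {x} = 0" if "e \<in> E" for e
      using less(2) that by (auto simp: rooted_def W flux_def)
    moreover have "2 * k dvd c x" using less(2) by (simp add: rooted_def W)
    ultimately show ?thesis unfolding orientable_def W by (intro exI[of _ "\<lambda>_. 1"]) auto
  qed
qed

section \<open>Choosing signs\<close>

text \<open>The rooted theorem with a root without edges: since no norm exceeds \<open>k\<close>,
  cuts of size \<open>5 * k - 4\<close> meet the cut condition for every demand.\<close>

lemma mod_orientation:
  assumes k: "k \<ge> 3" "odd k" and fin: "finite W" "finite E" "W \<noteq> {}"
    and ends: "\<forall>e\<in>E. fst (g e) \<in> W \<and> snd (g e) \<in> W"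
    and conn: "\<And>A. A \<subseteq> W \<Longrightarrow> A \<noteq> {} \<Longrightarrow> A \<noteq> W \<Longrightarrow> 5 * k - 4 \<le> (\<Sum>e\<in>E. \<bar>flux (g e) A\<bar>)"
    and b: "k dvd sum b W"
  shows "\<exists>s. (\<forall>e\<in>E. s e = 1 \<or> s e = (-1::int)) \<and> (\<forall>v\<in>W. k dvd (\<Sum>e\<in>E. s e * flux (g e) {v}) - b v)"
proof -
  have k0: "k > 0" using k by simp
  \<comment> \<open>Adding the odd number \<open>k\<close> where needed corrects the parity and
    keeps the residue modulo \<open>k\<close>.\<close>
  define c where "c v = b v + k * ((b v - (\<Sum>e\<in>E. flux (g e) {v})) mod 2)" for v
  have par: "even (c v - (\<Sum>e\<in>E. flux (g e) {v}))" for v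
    using k(2) by (simp add: c_def) presburger
  have cb: "k dvd c v - b v" for v by (simp add: c_def)
  have "even (\<Sum>v\<in>W. c v - (\<Sum>e\<in>E. flux (g e) {v}))" using par by (intro dvd_sum) auto
  moreover have "(\<Sum>v\<in>W. \<Sum>e\<in>E. flux (g e) {v}) = 0"
    by (subst sum.swap) (use fin ends in \<open>simp add: sum_flux flux_ends\<close>)
  ultimately have "even (sum c W)" by (simp add: sum_subtractf)
  moreover have "k dvd sum c W"
  proof -
    have "k dvd (\<Sum>v\<in>W. c v - b v) + sum b W" by (rule dvd_add[OF dvd_sum[OF cb] b])
    then show ?thesis by (simp add: sum_subtractf)
  qed
  ultimately have c: "2 * k dvd sum c W" using k(2) by (intro divides_mult) auto
  have "root_bounded k 0 0" using k mod_norm_bounds[OF k0, of 0] by (simp add: root_bounded_def)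
  then have "rooted k W E g c (\<lambda>_. 0) (\<lambda>_. 0)" using fin ends c par by (simp add: rooted_def)
  moreover have "cut_condition k W E g c (\<lambda>_. 0) (\<lambda>_. 0) {}"
    unfolding cut_condition_def
  proof (intro allI impI)
    fix A assume "A \<subseteq> W" "A \<noteq> {}" "A \<noteq> W"
    then show "4 * k - 4 + mod_norm k (demand c (\<lambda>_. 0) (\<lambda>_. 0) A) \<le> rcut E g (\<lambda>_. 0) (\<lambda>_. 0) A"
      using conn[of A] mod_norm_bounds(2)[OF k0, of "demand c (\<lambda>_. 0) (\<lambda>_. 0) A"] by (simp add: rcut_def)
  qed
  ultimately have "orientable k W E g c" using orientation k fin by blast
  then obtain s where s: "\<forall>e\<in>E. s e = 1 \<or> s e = (-1::int)"
    "\<forall>v\<in>W. 2 * k dvd (\<Sum>e\<in>E. s e * flux (g e) {v}) - c v" unfolding orientable_def by blast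
  have "k dvd (\<Sum>e\<in>E. s e * flux (g e) {v}) - b v" if "v \<in> W" for v
  proof -
    have "k dvd (\<Sum>e\<in>E. s e * flux (g e) {v}) - c v" using s(2) that dvd_mult_right by blast
    then have "k dvd ((\<Sum>e\<in>E. s e * flux (g e) {v}) - c v) + (c v - b v)" using cb by (rule dvd_add)
    then show ?thesis by simp
  qed
  then show ?thesis using s(1) by blast
qed

text \<open>As long as some cut has at most \<open>m\<close> edges, one of its two sides is again
  too dense, and the search continues there. It cannot end at a single vertex, which spans no edges
  but loops.\<close>

lemma dense_subgraph:
  fixes m :: int and g :: "'e \<Rightarrow> 'v \<times> 'v"
  defines "num \<equiv> \<lambda>F U. \<Sum>e\<in>F. of_bool (fst (g e) \<in> U \<and> snd (g e) \<in> U \<and> fst (g e) \<noteq> snd (g e)) :: int"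
  assumes "finite W" "W \<noteq> {}" "finite F" "num F W > m * (int (card W) - 1)"
  shows "\<exists>U\<subseteq>W. 2 \<le> card U \<and>
    (\<forall>A. A \<subseteq> U \<longrightarrow> A \<noteq> {} \<longrightarrow> A \<noteq> U \<longrightarrow> m + 1 \<le> (\<Sum>e\<in>inside F g U. \<bar>flux (g e) A\<bar>))"
  using assms(2-)
proof (induction "card W" arbitrary: W rule: less_induct)
  case less
  show ?case
  proof (cases "\<exists>A. A \<subseteq> W \<and> A \<noteq> {} \<and> A \<noteq> W \<and> (\<Sum>e\<in>inside F g W. \<bar>flux (g e) A\<bar>) \<le> m")
    case True
    then obtain A where A: "A \<subseteq> W" "A \<noteq> {}" "A \<noteq> W" and cut: "(\<Sum>e\<in>inside F g W. \<bar>flux (g e) A\<bar>) \<le> m" by blast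
    let ?B = "W - A"
    have "(\<Sum>e\<in>inside F g W. \<bar>flux (g e) A\<bar>) = (\<Sum>e\<in>F. if fst (g e) \<in> W \<and> snd (g e) \<in> W then \<bar>flux (g e) A\<bar> else 0)"
      unfolding inside_def by (rule sum.inter_filter[OF less(4)])
    then have "num F W = num F A + num F ?B + (\<Sum>e\<in>inside F g W. \<bar>flux (g e) A\<bar>)"
      using A(1) by (auto simp: num_def abs_flux sum.distrib[symmetric] intro!: sum.cong)
    then have split: "num F W \<le> num F A + num F ?B + m" using cut by simp
    have c: "int (card W) = int (card A) + int (card ?B)"
      using A(1) less(2) finite_subset[OF A(1)] card_mono[OF less(2) A(1)] by (simp add: card_Diff_subset of_nat_diff)
    \<comment> \<open>The bound for \<open>W\<close> is the sum of the bounds for the two sides plus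
      \<open>m\<close>, exactly what the cut may contain.\<close>
    have "m * (int (card W) - 1) = m * (int (card A) - 1) + m * (int (card ?B) - 1) + m"
      unfolding c by (simp add: algebra_simps)
    then have "num F A > m * (int (card A) - 1) \<or> num F ?B > m * (int (card ?B) - 1)"
      using split less(5) by linarith
    then obtain U where U: "U \<subseteq> W" "U \<noteq> {}" "U \<noteq> W" "num F U > m * (int (card U) - 1)"
      using A by blast
    then have "card U < card W" using less(2) by (simp add: psubset_card_mono psubset_eq)
    then obtain U' where "U' \<subseteq> U" "2 \<le> card U'"
      "\<forall>A. A \<subseteq> U' \<longrightarrow> A \<noteq> {} \<longrightarrow> A \<noteq> U' \<longrightarrow> m + 1 \<le> (\<Sum>e\<in>inside F g U'. \<bar>flux (g e) A\<bar>)"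
      using less(1)[OF _ finite_subset[OF U(1) less(2)] U(2) less(4) U(4)] by blast
    then show ?thesis using U(1) by (intro exI[of _ U'] conjI) auto
  next
    case False
    have "2 \<le> card W"
    proof (rule ccontr)
      assume "\<not> ?thesis"
      moreover have "card W \<noteq> 0" using less(2,3) by simp
      ultimately have "card W = 1" by linarith
      then obtain x where "W = {x}" by (auto simp: card_1_singleton_iff)
      then have "num F W = 0" by (auto simp: num_def intro!: sum.neutral)
      then show False using less(5) \<open>card W = 1\<close> by simp
    qed
    moreover have "m + 1 \<le> (\<Sum>e\<in>inside F g W. \<bar>flux (g e) A\<bar>)" if "A \<subseteq> W" "A \<noteq> {}" "A \<noteq> W" for A
      using False that by (meson not_le zless_imp_add1_zle)
    ultimately show ?thesis by (intro exI[of _ W]) simp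
  qed
qed

text \<open>Induction on the number of vertices: contracting \<open>U\<close> preserves the cut
  hypothesis, because each cut of the contracted graph is a cut of the original one.\<close>

lemma two_choice:
  fixes p :: int and W :: "'v set" and E :: "'e set"
  assumes p: "prime p" "p \<ge> 3"
    and "finite W" "finite E" "W \<noteq> {}"
    and "\<forall>e\<in>E. fst (g e) \<in> W \<and> snd (g e) \<in> W"
    and "\<forall>A. A \<subseteq> W \<longrightarrow> A \<noteq> {} \<longrightarrow> A \<noteq> W \<longrightarrow> (6 * p - 8) * (p - 1) \<le> (\<Sum>e\<in>E. \<bar>flux (g e) A\<bar>)"
    and h: "\<forall>e\<in>E. \<not> p dvd h e" and "p dvd sum b W"
  shows "\<exists>s. (\<forall>e\<in>E. s e = 1 \<or> s e = (-1::int)) \<and> (\<forall>v\<in>W. p dvd (\<Sum>e\<in>E. s e * h e * flux (g e) {v}) - b v)"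
  using assms(3-7,9)
proof (induction "card W" arbitrary: W g b rule: less_induct)
  case (less W g b)
  note fin = less(2,3) and ne = less(4) and ends = less(5)[rule_format] and conn = less(6)[rule_format] and b = less(7)
  have "odd p" using p prime_odd_int[of p] by simp
  show ?case
  proof (cases "2 \<le> card W")
    case False
    moreover have "card W \<noteq> 0" using fin ne by simp
    ultimately have "card W = 1" by linarith
    then obtain x where W: "W = {x}" by (auto simp: card_1_singleton_iff)
    have "flux (g e) {x} = 0" if "e \<in> E" for e using ends[OF that] by (auto simp: W flux_def)
    then show ?thesis using b by (intro exI[of _ "\<lambda>_. 1"]) (auto simp: W)
  next
    case True
    define colour where "colour e = min (h e mod p) (p - h e mod p)" for e
    define F where "F j = {e \<in> E. colour e = j}" for j
    define J where "J = {1..(p - 1) div 2}"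
    \<comment> \<open>Loops, which contractions create, are left out of the count because they
      contribute to no cut.\<close>
    let ?num = "\<lambda>F. \<Sum>e\<in>F. of_bool (fst (g e) \<in> W \<and> snd (g e) \<in> W \<and> fst (g e) \<noteq> snd (g e)) :: int"
    have colour: "colour e \<in> J" if "e \<in> E" for e
    proof -
      have "h e mod p \<noteq> 0" using h that by (simp add: dvd_eq_mod_eq_0)
      moreover have "0 \<le> h e mod p" "h e mod p < p" using p by auto
      moreover obtain q where "p = 2 * q + 1" using \<open>odd p\<close> by (rule oddE)
      ultimately show ?thesis unfolding colour_def J_def min_def by auto
    qed
    have "\<exists>j\<in>J. ?num (F j) > (5 * p - 5) * (int (card W) - 1)"
    proof (rule ccontr)
      assume "\<not> ?thesis"
      then have small: "?num (F j) \<le> (5 * p - 5) * (int (card W) - 1)" if "j \<in> J" for j using that by force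
      have "(6 * p - 8) * (p - 1) * int (card W) = (\<Sum>v\<in>W. (6 * p - 8) * (p - 1))" by simp
      also have "\<dots> \<le> (\<Sum>v\<in>W. \<Sum>e\<in>E. \<bar>flux (g e) {v}\<bar>)"
        by (rule sum_mono, rule conn) (use True in auto)
      also have "\<dots> = (\<Sum>e\<in>E. 2 * of_bool (fst (g e) \<in> W \<and> snd (g e) \<in> W \<and> fst (g e) \<noteq> snd (g e)))"
      proof (subst sum.swap, rule sum.cong[OF refl])
        fix e assume e: "e \<in> E"
        obtain x y where xy: "g e = (x, y)" by fastforce
        have W: "x \<in> W" "y \<in> W" using ends[OF e] xy by auto
        have "(\<Sum>v\<in>W. \<bar>flux (g e) {v}\<bar>) = (\<Sum>v\<in>W. of_bool (x \<noteq> y) * ((if v = x then 1 else 0) + (if v = y then 1 else 0)))"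
          by (rule sum.cong) (auto simp: xy)
        also have "\<dots> = of_bool (x \<noteq> y) * 2" using W fin
          by (simp add: sum_distrib_left[symmetric] sum.distrib del: sum.delta_remove)
        finally show "(\<Sum>v\<in>W. \<bar>flux (g e) {v}\<bar>) = 2 * of_bool (fst (g e) \<in> W \<and> snd (g e) \<in> W \<and> fst (g e) \<noteq> snd (g e))"
          using W xy by simp
      qed
      also have "\<dots> = 2 * ?num E" by (simp only: sum_distrib_left)
      also have "?num E = (\<Sum>j\<in>J. ?num (F j))"
        unfolding F_def by (rule sum.group[symmetric]) (use fin colour in \<open>auto simp: J_def\<close>)
      also have "\<dots> \<le> (\<Sum>j\<in>J. (5 * p - 5) * (int (card W) - 1))" by (rule sum_mono[OF small])
      also have "\<dots> = ((p - 1) div 2) * ((5 * p - 5) * (int (card W) - 1))"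
        using p by (simp add: J_def)
      also have "2 * (((p - 1) div 2) * ((5 * p - 5) * (int (card W) - 1))) = (p - 1) * ((5 * p - 5) * (int (card W) - 1))"
        using \<open>odd p\<close> by (simp add: mult.assoc[symmetric])
      finally have "(p - 1) * ((6 * p - 8) * int (card W)) \<le> (p - 1) * ((5 * p - 5) * (int (card W) - 1))"
        by (simp add: mult_ac)
      then have "(6 * p - 8) * int (card W) \<le> (5 * p - 5) * (int (card W) - 1)"
        using p by simp
      \<comment> \<open>Uses \<open>5 * p - 5 \<le> 6 * p - 8\<close>, that is,
        \<open>p \<ge> 3\<close>.\<close>
      also have "\<dots> \<le> (6 * p - 8) * (int (card W) - 1)" using p True by (intro mult_right_mono) auto
      finally show False using p by (simp add: algebra_simps)
    qed
    then obtain j where j: "j \<in> J" "?num (F j) > (5 * p - 5) * (int (card W) - 1)" by blast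
    have "finite (F j)" using fin by (simp add: F_def)
    then obtain U where U: "U \<subseteq> W" "2 \<le> card U"
      and UA: "\<And>A. A \<subseteq> U \<Longrightarrow> A \<noteq> {} \<Longrightarrow> A \<noteq> U \<Longrightarrow> 5 * p - 5 + 1 \<le> (\<Sum>e\<in>inside (F j) g U. \<bar>flux (g e) A\<bar>)"
      using dense_subgraph[OF fin(1) ne _ j(2)] by blast
    define H where "H = inside (F j) g U"
    have H: "H \<subseteq> E" "finite H" "\<And>e. e \<in> H \<Longrightarrow> fst (g e) \<in> U \<and> snd (g e) \<in> U" "\<And>e. e \<in> H \<Longrightarrow> colour e = j"
      using fin by (auto simp: H_def inside_def F_def)
    have fU: "finite U" using U fin finite_subset by blast
    have "U \<noteq> {}" using U by auto
    then obtain a where a: "a \<in> U" by blast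
    let ?W = "insert a (W - U)" and ?g = "map_prod (collapse U a) (collapse U a) \<circ> g" and ?b = "b(a := sum b U)"
    have "card ?W = card W - card U + 1" using fin fU U a by (simp add: card_Diff_subset)
    then have cW: "card ?W < card W" using U(2) card_mono[OF fin(1) U(1)] by linarith
    have "\<exists>s. (\<forall>e\<in>E. s e = 1 \<or> s e = (-1::int)) \<and> (\<forall>v\<in>?W. p dvd (\<Sum>e\<in>E. s e * h e * flux (?g e) {v}) - ?b v)"
    proof (rule less(1)[OF cW])
      show "\<forall>e\<in>E. fst (?g e) \<in> ?W \<and> snd (?g e) \<in> ?W" using ends by (auto simp: collapse_def)
      show "\<forall>B. B \<subseteq> ?W \<longrightarrow> B \<noteq> {} \<longrightarrow> B \<noteq> ?W \<longrightarrow> (6 * p - 8) * (p - 1) \<le> (\<Sum>e\<in>E. \<bar>flux (?g e) B\<bar>)"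
      proof (intro allI impI)
        fix B assume B: "B \<subseteq> ?W" "B \<noteq> {}" "B \<noteq> ?W"
        show "(6 * p - 8) * (p - 1) \<le> (\<Sum>e\<in>E. \<bar>flux (?g e) B\<bar>)"
          using conn[OF uncollapse_proper[OF U(1) a B]] by (simp add: flux_collapse[OF a B(1)])
      qed
      have "sum ?b ?W = sum b W" using sum_uncollapse[OF fin(1) U(1) a subset_refl] uncollapse_self[OF U(1) a] by metis
      then show "p dvd sum ?b ?W" using b by simp
    qed (use fin in auto)
    then obtain s0 where s0: "\<forall>e\<in>E. s0 e = 1 \<or> s0 e = (-1::int)"
      and s0W: "\<And>v. v \<in> ?W \<Longrightarrow> p dvd (\<Sum>e\<in>E. s0 e * h e * flux (?g e) {v}) - ?b v" by blast
    have out: "p dvd (\<Sum>e\<in>E. s0 e * h e * flux (g e) {v}) - b v" if "v \<in> W - U" for v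
    proof -
      have "v \<noteq> a" using that a by blast
      then show ?thesis using s0W[of v] that flux_collapse[OF a, of "{v}" W] by (simp add: uncollapse_def)
    qed
    have "uncollapse U a {a} = U" using a by (auto simp: uncollapse_def)
    then have tot: "p dvd (\<Sum>e\<in>E. s0 e * h e * flux (g e) U) - sum b U"
      using s0W[of a] flux_collapse[OF a, of "{a}" W] by simp
    \<comment> \<open>The boundary left to the edges of \<open>H\<close> once the signs of
      \<open>s0\<close> on \<open>H\<close> are discarded. It sums to 0 modulo \<open>p\<close> over
      \<open>U\<close>, since the edges of \<open>H\<close> have both ends in
      \<open>U\<close>.\<close>
    define r where "r v = b v - (\<Sum>e\<in>E - H. s0 e * h e * flux (g e) {v})" for v
    have split: "sum f E = sum f (E - H) + sum f H" for f :: "'e \<Rightarrow> int"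
      using sum.subset_diff[OF H(1) fin(2)] .
    have "(\<Sum>v\<in>U. \<Sum>e\<in>E - H. s0 e * h e * flux (g e) {v}) = (\<Sum>e\<in>E - H. s0 e * h e * flux (g e) U)"
      by (subst sum.swap) (simp add: sum_flux[OF fU] sum_distrib_left[symmetric])
    also have "\<dots> = (\<Sum>e\<in>E. s0 e * h e * flux (g e) U)"
      using H(3) by (simp add: split flux_ends)
    finally have "sum r U = - ((\<Sum>e\<in>E. s0 e * h e * flux (g e) U) - sum b U)"
      by (simp add: r_def sum_subtractf)
    then have rU: "p dvd sum r U" using tot by (simp only: dvd_minus_iff)
    have "0 < j" "j < p" using j p by (auto simp: J_def)
    then have "coprime j p" using p prime_imp_coprime_int[of p j] zdvd_not_zless[of j p] by (auto simp: coprime_commute)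
    \<comment> \<open>\<open>i\<close> inverts the common colour \<open>j\<close> modulo
      \<open>p\<close>, which turns the target \<open>r v\<close> into the net outdegree
      \<open>i * r v\<close>.\<close>
    then obtain i y where "i * j + y * p = 1" using bezout_int[of j p] by auto
    then have "j * i - 1 = p * (- y)" by (simp add: algebra_simps)
    then have i: "p dvd j * i - 1" by simp
    \<comment> \<open>On \<open>H\<close> every \<open>h e\<close> is congruent to
      \<open>t e * j\<close>, so the sign \<open>t e * \<sigma> e\<close> contributes
      \<open>\<sigma> e * j\<close>.\<close>
    define t where "t e = (if h e mod p = j then 1 else -1 :: int)" for e
    have th: "p dvd h e - t e * j" if "e \<in> H" for e
    proof (cases "h e mod p = j")
      case True
      then show ?thesis by (auto simp: t_def minus_mod_eq_mult_div)
    next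
      case False
      then have "h e mod p = p - j" using H(4)[OF that] by (auto simp: colour_def min_def split: if_splits)
      then have "h e + j = p * (h e div p) + p" using mult_div_mod_eq[of p "h e"] by linarith
      then show ?thesis using False by (simp add: t_def)
    qed
    have "\<exists>\<sigma>. (\<forall>e\<in>H. \<sigma> e = 1 \<or> \<sigma> e = (-1::int)) \<and> (\<forall>v\<in>U. p dvd (\<Sum>e\<in>H. \<sigma> e * flux (g e) {v}) - i * r v)"
    proof (rule mod_orientation)
      show "5 * p - 4 \<le> (\<Sum>e\<in>H. \<bar>flux (g e) A\<bar>)" if "A \<subseteq> U" "A \<noteq> {}" "A \<noteq> U" for A
        using UA[OF that] by (simp add: H_def)
      show "p dvd (\<Sum>v\<in>U. i * r v)" using rU by (simp add: sum_distrib_left[symmetric])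
    qed (use p \<open>odd p\<close> fU H \<open>U \<noteq> {}\<close> in auto)
    then obtain \<sigma> where \<sigma>: "\<forall>e\<in>H. \<sigma> e = 1 \<or> \<sigma> e = (-1::int)"
      and \<sigma>U: "\<And>v. v \<in> U \<Longrightarrow> p dvd (\<Sum>e\<in>H. \<sigma> e * flux (g e) {v}) - i * r v" by blast
    define s where "s e = (if e \<in> H then t e * \<sigma> e else s0 e)" for e
    have sEH: "(\<Sum>e\<in>E - H. s e * h e * flux (g e) {v}) = (\<Sum>e\<in>E - H. s0 e * h e * flux (g e) {v})" for v
      by (rule sum.cong) (auto simp: s_def)
    have "p dvd (\<Sum>e\<in>E. s e * h e * flux (g e) {v}) - b v" if v: "v \<in> W" for v
    proof (cases "v \<in> U")
      case False
      then have "flux (g e) {v} = 0" if "e \<in> H" for e using H(3)[OF that] by (auto simp: flux_def)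
      then have "(\<Sum>e\<in>E. s e * h e * flux (g e) {v}) = (\<Sum>e\<in>E. s0 e * h e * flux (g e) {v})"
        by (simp add: split sEH)
      then show ?thesis using out False v by simp
    next
      case True
      have "p dvd (\<Sum>e\<in>H. (h e - t e * j) * (s e * flux (g e) {v}))" using th by (intro dvd_sum dvd_mult2)
      moreover have "p dvd j * ((\<Sum>e\<in>H. \<sigma> e * flux (g e) {v}) - i * r v)" using \<sigma>U[OF True] by (rule dvd_mult)
      moreover have "p dvd (j * i - 1) * r v" using i by (rule dvd_mult2)
      ultimately have "p dvd (\<Sum>e\<in>H. (h e - t e * j) * (s e * flux (g e) {v})) +
         j * ((\<Sum>e\<in>H. \<sigma> e * flux (g e) {v}) - i * r v) + (j * i - 1) * r v" by (intro dvd_add)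
      also have "(\<Sum>e\<in>H. (h e - t e * j) * (s e * flux (g e) {v})) =
          (\<Sum>e\<in>H. s e * h e * flux (g e) {v}) - j * (\<Sum>e\<in>H. \<sigma> e * flux (g e) {v})"
        unfolding sum_distrib_left sum_subtractf[symmetric]
        by (rule sum.cong) (auto simp: s_def t_def algebra_simps)
      finally have "p dvd (\<Sum>e\<in>H. s e * h e * flux (g e) {v}) - r v" by (simp add: algebra_simps)
      moreover have "(\<Sum>e\<in>E. s e * h e * flux (g e) {v}) - b v = (\<Sum>e\<in>H. s e * h e * flux (g e) {v}) - r v"
        by (simp add: r_def split sEH)
      ultimately show ?thesis by (simp only:)
    qed
    moreover have "\<forall>e\<in>E. s e = 1 \<or> s e = -1" using s0 \<sigma> by (auto simp: s_def t_def)
    ultimately show ?thesis by blast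
  qed
qed

section \<open>From lists of two values to signs\<close>

theorem theorem8:
  fixes G :: "('a,'b) pre_digraph" and p :: int
    and L :: "'b \<Rightarrow> int set" and \<beta> :: "'a \<Rightarrow> int"
  assumes "prime p" and "p \<ge> 3"
    and "fin_digraph G" and "loopfree_digraph G"
    and "edge_connected (nat ((6 * p - 8) * (p - 1))) G"
    and "\<forall>e \<in> arcs G. L e \<subseteq> {0..<p} \<and> card (L e) = 2"
    and "is_Zp_boundary p G \<beta>"
  shows "\<exists>f. is_Zp_flow p G \<beta> f \<and> (\<forall>e \<in> arcs G. f e \<in> L e)"
proof (cases "verts G = {}")
  case True
  then have "arcs G = {}" using assms(3) wf_digraph.tail_in_verts by (fastforce simp: fin_digraph_def)
  then show ?thesis using True by (auto simp: is_Zp_flow_def)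
next
  case False
  interpret fin_digraph G by fact
  define g where "g e = (tail G e, head G e)" for e
  have fin: "finite (verts G)" "finite (arcs G)" by simp_all
  have net: "(\<Sum>e\<in>out_arcs G v. f e) - (\<Sum>e\<in>in_arcs G v. f e) = (\<Sum>e\<in>arcs G. f e * flux (g e) {v})"
    for f :: "'b \<Rightarrow> int" and v
  proof -
    have "(\<Sum>e\<in>out_arcs G v. f e) = (\<Sum>e\<in>arcs G. if tail G e = v then f e else 0)"
      unfolding out_arcs_def by (rule sum.inter_filter) simp
    moreover have "(\<Sum>e\<in>in_arcs G v. f e) = (\<Sum>e\<in>arcs G. if head G e = v then f e else 0)"
      unfolding in_arcs_def by (rule sum.inter_filter) simp
    ultimately show ?thesis
      by (auto simp: g_def sum_subtractf[symmetric] intro!: sum.cong)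
  qed
  have "\<exists>a b. L e = {a, b} \<and> a \<noteq> b" if "e \<in> arcs G" for e
    using assms(6) that by (auto simp: card_2_iff)
  then obtain a b where ab: "\<And>e. e \<in> arcs G \<Longrightarrow> L e = {a e, b e} \<and> a e \<noteq> b e" by metis
  have rng: "0 \<le> a e" "a e < p" "0 \<le> b e" "b e < p" if "e \<in> arcs G" for e
    using assms(6) ab[OF that] that by fastforce+
  have "odd p" using assms(1,2) prime_odd_int[of p] by simp
  then obtain q where q: "p = 2 * q + 1" by (rule oddE)
  \<comment> \<open>As \<open>p = 2 * q + 1\<close>, the factor \<open>q + 1\<close> is the inverse
    of 2 modulo \<open>p\<close>; so \<open>m e\<close> and \<open>h e\<close> are half the sum and
    half the difference of the two listed values.\<close>
  define m where "m e = (q + 1) * (a e + b e)" for e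
  define h where "h e = (q + 1) * (b e - a e)" for e
  have mh: "p dvd m e + h e - b e" "p dvd m e - h e - a e" for e
  proof -
    have "m e + h e - b e = p * b e" "m e - h e - a e = p * a e"
      by (simp_all add: m_def h_def q algebra_simps)
    then show "p dvd m e + h e - b e" "p dvd m e - h e - a e" by simp_all
  qed
  have hne: "\<forall>e\<in>arcs G. \<not> p dvd h e"
  proof (intro ballI notI)
    fix e assume e: "e \<in> arcs G" "p dvd h e"
    have "b e - a e = 2 * h e - p * (b e - a e)" by (simp add: h_def q algebra_simps)
    then have "p dvd b e - a e" using e(2) by (metis dvd_diff dvd_mult dvd_triv_left)
    then have "b e mod p = a e mod p" by (simp add: mod_eq_dvd_iff)
    then show False using rng[OF e(1)] ab[OF e(1)] by simp
  qed
  define r where "r v = \<beta> v - (\<Sum>e\<in>arcs G. m e * flux (g e) {v})" for v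
  have ends: "\<forall>e\<in>arcs G. fst (g e) \<in> verts G \<and> snd (g e) \<in> verts G" by (simp add: g_def)
  have "\<exists>s. (\<forall>e\<in>arcs G. s e = 1 \<or> s e = (-1::int)) \<and>
     (\<forall>v\<in>verts G. p dvd (\<Sum>e\<in>arcs G. s e * h e * flux (g e) {v}) - r v)"
  proof (rule two_choice[OF assms(1,2) fin False ends _ hne])
    show "\<forall>A. A \<subseteq> verts G \<longrightarrow> A \<noteq> {} \<longrightarrow> A \<noteq> verts G \<longrightarrow>
        (6 * p - 8) * (p - 1) \<le> (\<Sum>e\<in>arcs G. \<bar>flux (g e) A\<bar>)"
    proof (intro allI impI)
      fix A assume A: "A \<subseteq> verts G" "A \<noteq> {}" "A \<noteq> verts G"
      have "(6 * p - 8) * (p - 1) \<le> int (card (cut_arcs G A))"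
        using assms(5) A unfolding edge_connected_def by (simp add: nat_le_iff)
      also have "int (card (cut_arcs G A)) = (\<Sum>e\<in>arcs G. of_bool ((tail G e \<in> A) \<noteq> (head G e \<in> A)))"
        by (simp add: cut_arcs_def Int_def)
      also have "\<dots> = (\<Sum>e\<in>arcs G. \<bar>flux (g e) A\<bar>)"
        by (simp only: abs_flux g_def fst_conv snd_conv)
      finally show "(6 * p - 8) * (p - 1) \<le> (\<Sum>e\<in>arcs G. \<bar>flux (g e) A\<bar>)" .
    qed
    have "(\<Sum>v\<in>verts G. \<Sum>e\<in>arcs G. m e * flux (g e) {v}) = 0"
      by (subst sum.swap) (use ends in \<open>simp add: sum_flux flux_ends sum_distrib_left[symmetric]\<close>)
    then show "p dvd sum r (verts G)"
      using assms(7) by (simp add: r_def sum_subtractf is_Zp_boundary_def dvd_eq_mod_eq_0)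
  qed
  then obtain s where s: "\<And>e. e \<in> arcs G \<Longrightarrow> s e = 1 \<or> s e = (-1::int)"
    and sv: "\<And>v. v \<in> verts G \<Longrightarrow> p dvd (\<Sum>e\<in>arcs G. s e * h e * flux (g e) {v}) - r v" by blast
  \<comment> \<open>Sign 1 selects \<open>m e + h e\<close>, which is \<open>b e\<close> modulo
    \<open>p\<close>, and sign -1 selects \<open>m e - h e\<close>, which is
    \<open>a e\<close>.\<close>
  define f where "f e = (if s e = 1 then b e else a e)" for e
  have fm: "p dvd m e + s e * h e - f e" if "e \<in> arcs G" for e
    using s[OF that] mh[of e] by (auto simp: f_def)
  have "is_Zp_flow p G \<beta> f"
    unfolding is_Zp_flow_def
  proof (intro conjI ballI)
    show "f e \<in> {0..<p}" if "e \<in> arcs G" for e using rng[OF that] by (simp add: f_def)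
    fix v assume v: "v \<in> verts G"
    have "p dvd (\<Sum>e\<in>arcs G. (m e + s e * h e - f e) * flux (g e) {v})"
      by (intro dvd_sum dvd_mult2 fm)
    then have "p dvd ((\<Sum>e\<in>arcs G. s e * h e * flux (g e) {v}) - r v) -
        (\<Sum>e\<in>arcs G. (m e + s e * h e - f e) * flux (g e) {v})"
      by (rule dvd_diff[OF sv[OF v]])
    also have "\<dots> = (\<Sum>e\<in>arcs G. f e * flux (g e) {v}) - \<beta> v"
      by (simp add: r_def algebra_simps sum.distrib sum_subtractf)
    finally show "(sum f (out_arcs G v) - sum f (in_arcs G v)) mod p = \<beta> v mod p"
      unfolding net by (simp add: mod_eq_dvd_iff)
  qed
  moreover have "f e \<in> L e" if "e \<in> arcs G" for e using ab[OF that] by (simp add: f_def)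
  ultimately show ?thesis by blast
qed

end
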